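(* Let $0<p_n<n$ with $p_n=o(n)$. Let $a\ge\frac12$, let $K>0$, and let $\pi'(t)=K\,t^{-(a+1)}L(t)$, $t>0$, be a probability density (not depending on $n$), where $L:(0,\infty)\to(0,\infty)$ is non-constant and there exist $c_0,M,t_0\in(0,\infty)$ with $L(t)>c_0$ for all $t\ge t_0$ and $\sup_{t\in(0,\infty)}L(t)\le M$. Let $\tau=(p_n/n)^\alpha$ for some constant $\alpha\geq 0$, and assume that: if $\frac12\le a<1$, then $\tau^{2a}\le\frac{p_n}{n}\sqrt{\log(n/p_n)}$; if $a=1$, then $\tau^2\le\frac{p_n}{n}$; if $a>1$, then $\tau^2\le\frac{p_n}{n}\log(n/p_n)$. Consider the prior under which, independently for $i=1,\dots,n$, $\theta_i\mid\sigma_i^2\sim\mathcal N(0,\sigma_i^2\tau^2)$, $\sigma_i^2\sim\pi'$; equivalently the scale-mixture-of-normals prior with mixing density $\pi(u)=\frac{K\tau^{2a}}{u^{1+a}}L\big(\frac{u}{\tau^2}\big)$. Then for every positive sequence $M_n\to\infty$, $$\sup_{\theta_0\in\ell_0[p_n]}\mathbb E_{\theta_0}\Pi\big(\theta:\|\theta-\theta_0\|^2>M_np_n\log(n/p_n)\,\big|\,X^n\big)\to0 \quad\text{and}\quad \sup_{\theta_0\in\ell_0[p_n]}\mathbb E_{\theta_0}\|\widehat\theta-\theta_0\|^2\lesssim p_n\log(n/p_n).$$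
   Context: Model: for each $n$, $X^n=(X_1,\dots,X_n)\sim\mathcal N(\theta_0,I_n)$ with $\theta_0\in\mathbb R^n$; $\mathbb E_{\theta_0}$ is expectation under this law. $\ell_0[p_n]=\{\theta\in\mathbb R^n:\sum_{i=1}^n\mathbf 1\{\theta_i\ne0\}\le p_n\}$. The scale-mixture-of-normals prior with mixing density $\pi$ (a possibly $n$-dependent probability density on $[0,\infty)$): independently for $i=1,\dots,n$, $\theta_i\mid v_i\sim\mathcal N(0,v_i)$ and $v_i\sim\pi$. $\Pi(\cdot\mid X^n)$ is the posterior distribution of $\theta=(\theta_1,\dots,\theta_n)$ when $X^n\mid\theta\sim\mathcal N(\theta,I_n)$, and $\widehat\theta$ is the coordinatewise posterior mean. $\|\cdot\|$ is the Euclidean norm. Limits are as $n\to\infty$; $A_n\lesssim B_n$ means $A_n\le C_0B_n$ for all sufficiently large $n$ with a constant $C_0$ independent of $n$. *)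

theory Defs
  imports "HOL-Probability.Probability" "HOL-Library.Landau_Symbols"
begin

text \<open>Vectors in \<open>\<real>\<^sup>n\<close> are functions on \<open>{..<n}\<close> that are \<open>undefined\<close>
  elsewhere, i.e. the elements of \<open>space (\<Pi>\<^sub>M i\<in>{..<n}. borel)\<close>; the coordinates are numbered from 0.
  The Euclidean norm of \<open>\<theta>\<close> is \<open>L2_set \<theta> {..<n}\<close>.\<close>

definition real_vectors :: "nat \<Rightarrow> (nat \<Rightarrow> real) set" where
  "real_vectors n = ({..<n} \<rightarrow>\<^sub>E UNIV)"

definition sparse_vectors :: "nat \<Rightarrow> real \<Rightarrow> (nat \<Rightarrow> real) set" where
  "sparse_vectors n p = {\<theta> \<in> real_vectors n. (\<Sum>i<n. of_bool (\<theta> i \<noteq> 0)) \<le> p}"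

text \<open>The normal law with mean \<open>m\<close> and \<^emph>\<open>variance\<close> \<open>v \<ge> 0\<close>
  (\<^const>\<open>normal_density\<close> takes the standard deviation); it degenerates to a Dirac mass at \<open>v = 0\<close>.
  Negative \<open>v\<close> is never used.\<close>

definition normal_law :: "real \<Rightarrow> real \<Rightarrow> real measure" where
  "normal_law m v =
     (if 0 < v then density lborel (\<lambda>x. ennreal (normal_density m (sqrt v) x)) else return borel m)"

definition gaussian_model :: "nat \<Rightarrow> (nat \<Rightarrow> real) \<Rightarrow> (nat \<Rightarrow> real) measure" where
  "gaussian_model n \<theta>0 = (\<Pi>\<^sub>M i\<in>{..<n}. normal_law (\<theta>0 i) 1)"

definition is_prob_density :: "(real \<Rightarrow> real) \<Rightarrow> bool" where
  "is_prob_density f \<longleftrightarrow> f \<in> borel_measurable borel \<and> (\<forall>t. 0 \<le> f t) \<and>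
     (\<integral>\<^sup>+t. ennreal (f t) \<partial>lborel) = 1"

text \<open>The marginal law of one coordinate when \<open>\<sigma>\<^sup>2\<close> has density \<open>\<pi>\<close> and, given \<open>\<sigma>\<^sup>2\<close>,
  the coordinate is normal with mean 0 and variance \<open>\<sigma>\<^sup>2 \<tau>\<^sup>2\<close>.\<close>

definition scaled_normal_mixture :: "(real \<Rightarrow> real) \<Rightarrow> real \<Rightarrow> real measure" where
  "scaled_normal_mixture \<pi> \<tau> =
     density lborel (\<lambda>s. ennreal (\<pi> s)) \<bind> (\<lambda>s. normal_law 0 (s * \<tau>\<^sup>2))"

definition scaled_normal_mixture_prior ::
    "nat \<Rightarrow> (real \<Rightarrow> real) \<Rightarrow> real \<Rightarrow> (nat \<Rightarrow> real) measure" where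
  "scaled_normal_mixture_prior n \<pi> \<tau> = (\<Pi>\<^sub>M i\<in>{..<n}. scaled_normal_mixture \<pi> \<tau>)"

definition likelihood :: "nat \<Rightarrow> (nat \<Rightarrow> real) \<Rightarrow> (nat \<Rightarrow> real) \<Rightarrow> real" where
  "likelihood n \<theta> x = (\<Prod>i<n. normal_density (\<theta> i) 1 (x i))"

text \<open>The posterior given by Bayes' formula. For every \<open>x\<close> and every prior probability the
  likelihood is positive and bounded, so the normalising constant is positive and finite.\<close>

definition posterior ::
    "nat \<Rightarrow> (nat \<Rightarrow> real) measure \<Rightarrow> (nat \<Rightarrow> real) \<Rightarrow> (nat \<Rightarrow> real) measure" where
  "posterior n P x = density P (\<lambda>\<theta>. ennreal (likelihood n \<theta> x) /
     (\<integral>\<^sup>+\<eta>. ennreal (likelihood n \<eta> x) \<partial>P))"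

definition posterior_mean ::
    "nat \<Rightarrow> (nat \<Rightarrow> real) measure \<Rightarrow> (nat \<Rightarrow> real) \<Rightarrow> nat \<Rightarrow> real" where
  "posterior_mean n P x = (\<lambda>i\<in>{..<n}. \<integral>\<theta>. \<theta> i \<partial>(posterior n P x))"

definition sq_dist :: "nat \<Rightarrow> (nat \<Rightarrow> real) \<Rightarrow> (nat \<Rightarrow> real) \<Rightarrow> real" where
  "sq_dist n \<theta> \<eta> = (L2_set (\<lambda>i. \<theta> i - \<eta> i) {..<n})\<^sup>2"

text \<open>Expectations of nonnegative quantities, and their suprema, are taken in \<^typ>\<open>ennreal\<close>,
  where both always exist.\<close>

definition expected_posterior_mass_outside ::
    "nat \<Rightarrow> (nat \<Rightarrow> real) measure \<Rightarrow> (nat \<Rightarrow> real) \<Rightarrow> real \<Rightarrow> ennreal" where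
  "expected_posterior_mass_outside n P \<theta>0 r =
     (\<integral>\<^sup>+x. emeasure (posterior n P x) {\<theta> \<in> real_vectors n. sq_dist n \<theta> \<theta>0 > r}
        \<partial>(gaussian_model n \<theta>0))"

definition posterior_mean_risk ::
    "nat \<Rightarrow> (nat \<Rightarrow> real) measure \<Rightarrow> (nat \<Rightarrow> real) \<Rightarrow> ennreal" where
  "posterior_mean_risk n P \<theta>0 =
     (\<integral>\<^sup>+x. ennreal (sq_dist n (posterior_mean n P x) \<theta>0) \<partial>(gaussian_model n \<theta>0))"

definition power_mixing_density :: "real \<Rightarrow> real \<Rightarrow> (real \<Rightarrow> real) \<Rightarrow> real \<Rightarrow> real" where
  "power_mixing_density K a L t = (if 0 < t then K * t powr (- (a + 1)) * L t else 0)"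

subsection \<open>The equivalent prior with a rescaled mixing density\<close>

lemma normal_law_measurable [measurable]:
  "normal_law m \<in> borel \<rightarrow>\<^sub>M subprob_algebra borel"
proof (rule measurable_subprob_algebra)
  fix v :: real
  show "subprob_space (normal_law m v)"
    by (auto simp: normal_law_def intro!: prob_space_imp_subprob_space prob_space_normal_density
        prob_space_return)
  show "sets (normal_law m v) = sets borel"
    by (simp add: normal_law_def)
next
  fix A :: "real set" assume [measurable]: "A \<in> sets borel"
  have "(\<lambda>v. emeasure (normal_law m v) A) =
    (\<lambda>v. if 0 < v then (\<integral>\<^sup>+x. ennreal (normal_density m (sqrt v) x) * indicator A x \<partial>lborel)
         else indicator A m)"
    by (auto simp: normal_law_def emeasure_density)
  moreover have "\<dots> \<in> borel_measurable borel"
    unfolding normal_density_def by measurable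
  ultimately show "(\<lambda>v. emeasure (normal_law m v) A) \<in> borel_measurable borel"
    by simp
qed

lemma scaled_normal_mixture_rescale:
  fixes K a \<tau> :: real and L :: "real \<Rightarrow> real"
  defines "\<pi> \<equiv> \<lambda>u. if 0 < u then K * \<tau> powr (2 * a) / u powr (1 + a) * L (u / \<tau>\<^sup>2) else 0"
  assumes dens: "is_prob_density (power_mixing_density K a L)" and \<tau>: "0 < \<tau>"
  shows "scaled_normal_mixture (power_mixing_density K a L) \<tau> = scaled_normal_mixture \<pi> 1"
proof -
  let ?f = "power_mixing_density K a L"
  have f [measurable]: "?f \<in> borel_measurable borel"
    using dens by (simp add: is_prob_density_def)
  have \<pi>: "\<pi> u = ?f (u / \<tau>\<^sup>2) / \<tau>\<^sup>2" for u
  proof (cases "0 < u")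
    case True
    have "\<tau>\<^sup>2 powr a = \<tau> powr (2 * a)"
      using \<tau> by (simp add: powr_powr powr_numeral[symmetric] del: powr_numeral)
    then have "\<tau>\<^sup>2 powr (1 + a) = \<tau>\<^sup>2 * \<tau> powr (2 * a)"
      using \<tau> by (simp add: powr_add)
    moreover have "(u / \<tau>\<^sup>2) powr (- (a + 1)) = \<tau>\<^sup>2 powr (1 + a) / u powr (1 + a)"
      using \<tau> True powr_minus_divide[of "u / \<tau>\<^sup>2" "1 + a"]
      by (simp add: powr_divide add.commute del: powr_minus_divide)
    ultimately have "(u / \<tau>\<^sup>2) powr (- (a + 1)) / \<tau>\<^sup>2 = \<tau> powr (2 * a) / u powr (1 + a)"
      using \<tau> by simp
    then show ?thesis
      using \<tau> True by (simp add: \<pi>_def power_mixing_density_def field_simps)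
  next
    case False
    then show ?thesis using \<tau> by (simp add: \<pi>_def power_mixing_density_def zero_less_divide_iff)
  qed
  have meas: "(\<lambda>u. ennreal (\<pi> u)) \<in> borel_measurable borel"
    unfolding \<pi> by measurable
  have "density lborel (\<lambda>u. ennreal (\<pi> u)) =
        density (density lborel (\<lambda>_. ennreal (inverse \<bar>\<tau>\<^sup>2\<bar>))) (\<lambda>u. ennreal (?f (u / \<tau>\<^sup>2)))"
    using \<tau> by (subst density_density_eq)
      (auto simp: \<pi> divide_inverse ennreal_mult' mult.commute intro!: arg_cong2[of _ _ _ _ density])
  also have "\<dots> = density (distr lborel borel ((*) (\<tau>\<^sup>2))) (\<lambda>u. ennreal (?f (u / \<tau>\<^sup>2)))"
    using \<tau> by (subst lborel_distr_mult) auto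
  also have "\<dots> = distr (density lborel (\<lambda>s. ennreal (?f s))) borel ((*) (\<tau>\<^sup>2))"
    using \<tau> by (subst density_distr) auto
  finally have eq: "density lborel (\<lambda>u. ennreal (\<pi> u)) =
      distr (density lborel (\<lambda>s. ennreal (?f s))) borel ((*) (\<tau>\<^sup>2))" .
  show ?thesis
    unfolding scaled_normal_mixture_def eq
    by (subst bind_distr[where K = borel]) (auto simp: mult.commute)
qed

end

theory Submission
  imports Defs
begin

text \<open>
  Write \<open>s = p\<^sub>n / n\<close> and \<open>l = ln (1 / s)\<close>. Both claims follow from a single bound of order \<open>p\<^sub>n l\<close>
  on the expected posterior second moment of \<open>\<theta> - \<theta>\<^sub>0\<close>: Markov's inequality gives contraction of the
  posterior, Jensen's inequality gives the risk of the posterior mean. Prior and likelihood are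
  products, so the posterior is one as well and that second moment is a sum over the coordinates
  (\<open>expected_posterior_sq_dist\<close>). It therefore suffices to treat one coordinate, and to show that its
  risk is at most a constant times \<open>l\<close> for every mean and at most a constant times \<open>s l\<close> for mean zero
  (\<open>coordinate_risk_bounds\<close>); up to a constant, a sparse vector then costs at most
  \<open>n s l + p\<^sub>n l = 2 p\<^sub>n l\<close>.

  Everything about one coordinate is read off the normal mixture. Conditionally on the variance \<open>v\<close>
  the pair of coordinate and observation is Gaussian, so the evidence at \<open>x\<close> is a mixture of the
  normal densities with variance \<open>1 + v\<close>, and the posterior then has mean \<open>\<kappa> x\<close> and variance \<open>\<kappa>\<close>, with
  \<open>\<kappa> = v / (1 + v)\<close>.

  For an arbitrary mean the key fact (\<open>posterior_spread_about_observation\<close>) is deterministic: whatever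
  is observed, the posterior second moment about the observation \<open>x\<close> is at most a constant times \<open>l\<close>.
  If \<open>x\<^sup>2\<close> is itself of order \<open>l\<close>, this is clear, as shrinkage moves the observation by at most \<open>\<bar>x\<bar>\<close>. If
  \<open>x\<^sup>2\<close> is much larger, then the polynomial tail of the mixing density supplies variances of size \<open>x\<^sup>2\<close>,
  so the evidence decays only polynomially in \<open>\<bar>x\<bar>\<close> and in \<open>\<tau>\<close>, whereas a variance so small that
  it shrinks \<open>x\<close> by more than \<open>sqrt l\<close> makes \<open>x\<close> exponentially unlikely. As \<open>\<tau>\<close> is a power of \<open>s\<close>, the
  factor lost through \<open>\<tau>\<close> is the exponential of a multiple of \<open>l\<close>, which this exponential absorbs.

  For mean zero the observation exceeds \<open>\<zeta> = 2 * sqrt l\<close> with probability at most of order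
  \<open>exp (- \<zeta>\<^sup>2 / 4) = s\<close>, and there the previous bound suffices. On \<open>\<bar>x\<bar> \<le> \<zeta>\<close> the evidence is bounded below
  by a multiple of the standard normal density, which cancels the law of the observation and leaves an
  integral, over the mixing density, of the prior second moment restricted to \<open>\<bar>x\<bar> \<le> \<zeta>\<close>
  (\<open>coordinate_risk_zero_le\<close>). That moment is at most the smaller of \<open>v\<close> and a multiple of
  \<open>\<zeta>\<^sup>3 / sqrt v\<close>. Integrating it against \<open>t powr (- a - 1)\<close> at \<open>v = t \<tau>\<^sup>2\<close> gives terms of
  order \<open>\<tau> powr (2 * a) * sqrt l\<close> for \<open>a < 1\<close>, \<open>\<tau>\<^sup>2 * l\<close> for \<open>a = 1\<close> and \<open>\<tau>\<^sup>2\<close> for \<open>a > 1\<close>;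
  the three conditions on \<open>\<tau>\<close> say that these are at most of order \<open>s l\<close>.
\<close>

section \<open>Normal integrals and conjugacy\<close>

lemma normal_density_mean_measurable [measurable]:
  "(\<lambda>\<theta>. normal_density \<theta> 1 x) \<in> borel_measurable borel"
  unfolding normal_density_def by measurable

lemma normal_second_moment:
  fixes m \<mu> \<sigma> :: real
  assumes "0 < \<sigma>"
  shows "(\<integral>\<^sup>+\<theta>. ennreal ((\<theta> - m)\<^sup>2 * normal_density \<mu> \<sigma> \<theta>) \<partial>lborel) = ennreal (\<sigma>\<^sup>2 + (\<mu> - m)\<^sup>2)"
proof -
  let ?\<phi> = "normal_density \<mu> \<sigma>"
  have 0: "has_bochner_integral lborel (\<lambda>\<theta>. ?\<phi> \<theta>) 1"
    using normal_moment_even[where \<mu> = \<mu> and \<sigma> = \<sigma> and k = 0] assms by simp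
  have 1: "has_bochner_integral lborel (\<lambda>\<theta>. ?\<phi> \<theta> * (\<theta> - \<mu>)) 0"
    using normal_moment_odd[where \<mu> = \<mu> and \<sigma> = \<sigma> and k = 0] assms by simp
  have 2: "has_bochner_integral lborel (\<lambda>\<theta>. ?\<phi> \<theta> * (\<theta> - \<mu>)\<^sup>2) (\<sigma>\<^sup>2)"
    using normal_moment_even[where \<mu> = \<mu> and \<sigma> = \<sigma> and k = 1] assms by simp
  have "has_bochner_integral lborel
      (\<lambda>\<theta>. ?\<phi> \<theta> * (\<theta> - \<mu>)\<^sup>2 + (?\<phi> \<theta> * (\<theta> - \<mu>)) * (2 * (\<mu> - m)) + ?\<phi> \<theta> * (\<mu> - m)\<^sup>2)
      (\<sigma>\<^sup>2 + 0 * (2 * (\<mu> - m)) + 1 * (\<mu> - m)\<^sup>2)"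
    by (intro has_bochner_integral_add has_bochner_integral_mult_left 0 1 2)
  moreover have "(\<lambda>\<theta>. ?\<phi> \<theta> * (\<theta> - \<mu>)\<^sup>2 + (?\<phi> \<theta> * (\<theta> - \<mu>)) * (2 * (\<mu> - m)) + ?\<phi> \<theta> * (\<mu> - m)\<^sup>2)
      = (\<lambda>\<theta>. (\<theta> - m)\<^sup>2 * ?\<phi> \<theta>)"
    by (intro ext) algebra
  ultimately have "has_bochner_integral lborel (\<lambda>\<theta>. (\<theta> - m)\<^sup>2 * ?\<phi> \<theta>) (\<sigma>\<^sup>2 + (\<mu> - m)\<^sup>2)"
    by simp
  then show ?thesis
    by (subst nn_integral_eq_integral) (auto simp: has_bochner_integral_iff)
qed

text \<open>Bayes' formula for one normal observation of a normal mean, as an identity of joint densities: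
  prior times likelihood equals evidence times posterior.\<close>

lemma normal_conjugacy:
  fixes v x \<theta> :: real
  assumes v: "0 < v"
  defines "\<kappa> \<equiv> v / (1 + v)"
  shows "normal_density 0 (sqrt v) \<theta> * normal_density \<theta> 1 x
       = normal_density 0 (sqrt (1 + v)) x * normal_density (\<kappa> * x) (sqrt \<kappa>) \<theta>"
proof -
  have \<kappa>: "0 < \<kappa>" and u: "0 < 1 + v" using v by (auto simp: \<kappa>_def)
  have "sqrt (2 * pi * v) * sqrt (2 * pi) = sqrt (2 * pi * (1 + v)) * sqrt (2 * pi * \<kappa>)"
    using u by (simp add: real_sqrt_mult[symmetric] \<kappa>_def)
  moreover have "- (\<theta>\<^sup>2) / (2 * v) + - (x - \<theta>)\<^sup>2 / 2 = - x\<^sup>2 / (2 * (1 + v)) + - (\<theta> - \<kappa> * x)\<^sup>2 / (2 * \<kappa>)"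
    using v u unfolding \<kappa>_def by (simp add: divide_simps) algebra
  ultimately show ?thesis
    using v \<kappa> by (simp add: normal_density_def mult_exp_exp)
qed

lemma nn_integral_normal_law:
  assumes "0 < v" and [measurable]: "h \<in> borel_measurable borel"
  shows "(\<integral>\<^sup>+\<theta>. h \<theta> \<partial>normal_law m v)
       = (\<integral>\<^sup>+\<theta>. ennreal (normal_density m (sqrt v) \<theta>) * h \<theta> \<partial>lborel)"
  using assms by (simp add: normal_law_def nn_integral_density)

lemma sets_normal_law [simp, measurable_cong]: "sets (normal_law m v) = sets borel"
  by (simp add: normal_law_def)

lemma prob_space_normal_law: "prob_space (normal_law m v)"
  by (auto simp: normal_law_def intro!: prob_space_normal_density prob_space_return)

lemma nn_integral_conjugate_moment:
  fixes v m x :: real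
  assumes v: "0 < v"
  defines "\<kappa> \<equiv> v / (1 + v)"
  shows "(\<integral>\<^sup>+\<theta>. ennreal ((\<theta> - m)\<^sup>2 * normal_density \<theta> 1 x) \<partial>normal_law 0 v)
       = ennreal (normal_density 0 (sqrt (1 + v)) x * (\<kappa> + (\<kappa> * x - m)\<^sup>2))"
proof -
  have \<kappa>: "0 < \<kappa>" using v by (auto simp: \<kappa>_def)
  have "(\<integral>\<^sup>+\<theta>. ennreal ((\<theta> - m)\<^sup>2 * normal_density \<theta> 1 x) \<partial>normal_law 0 v)
      = (\<integral>\<^sup>+\<theta>. ennreal (normal_density 0 (sqrt (1 + v)) x) *
           ennreal ((\<theta> - m)\<^sup>2 * normal_density (\<kappa> * x) (sqrt \<kappa>) \<theta>) \<partial>lborel)"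
    using v normal_conjugacy[OF v, of _ x, folded \<kappa>_def]
    by (subst nn_integral_normal_law) (auto simp: ennreal_mult'[symmetric] ac_simps intro!: nn_integral_cong)
  also have "\<dots> = ennreal (normal_density 0 (sqrt (1 + v)) x) * ennreal (\<kappa> + (\<kappa> * x - m)\<^sup>2)"
    using \<kappa> by (subst nn_integral_cmult) (auto simp: normal_second_moment)
  finally show ?thesis
    using \<kappa> by (simp add: ennreal_mult' ennreal_plus del: ennreal_plus[symmetric])
qed

lemma nn_integral_conjugate_evidence:
  fixes v x :: real
  assumes v: "0 < v"
  shows "(\<integral>\<^sup>+\<theta>. ennreal (normal_density \<theta> 1 x) \<partial>normal_law 0 v)
       = ennreal (normal_density 0 (sqrt (1 + v)) x)"
proof -
  define \<kappa> where "\<kappa> = v / (1 + v)"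
  have \<kappa>: "0 < \<kappa>" using v by (auto simp: \<kappa>_def)
  have "(\<integral>\<^sup>+\<theta>. ennreal (normal_density \<theta> 1 x) \<partial>normal_law 0 v)
      = (\<integral>\<^sup>+\<theta>. ennreal (normal_density 0 (sqrt (1 + v)) x) *
           ennreal (normal_density (\<kappa> * x) (sqrt \<kappa>) \<theta>) \<partial>lborel)"
    using v normal_conjugacy[OF v, of _ x, folded \<kappa>_def]
    by (subst nn_integral_normal_law) (auto simp: ennreal_mult'[symmetric] ac_simps intro!: nn_integral_cong)
  also have "\<dots> = ennreal (normal_density 0 (sqrt (1 + v)) x) * 1"
    using \<kappa> prob_space.emeasure_space_1[OF prob_space_normal_density[of "sqrt \<kappa>" "\<kappa> * x"]]
    by (subst nn_integral_cmult) (auto simp: emeasure_density)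
  finally show ?thesis by simp
qed

section \<open>The prior of one coordinate\<close>

lemma normal_law_scaled_measurable [measurable]:
  "(\<lambda>s. normal_law 0 (s * \<tau>\<^sup>2)) \<in> borel \<rightarrow>\<^sub>M subprob_algebra borel"
  by measurable

lemma sets_scaled_normal_mixture [simp, measurable_cong]:
  "sets (scaled_normal_mixture f \<tau>) = sets borel"
  by (simp add: scaled_normal_mixture_def)

lemma nn_integral_scaled_normal_mixture:
  assumes [measurable]: "f \<in> borel_measurable borel" "h \<in> borel_measurable borel"
  shows "(\<integral>\<^sup>+\<theta>. h \<theta> \<partial>scaled_normal_mixture f \<tau>)
       = (\<integral>\<^sup>+t. ennreal (f t) * (\<integral>\<^sup>+\<theta>. h \<theta> \<partial>normal_law 0 (t * \<tau>\<^sup>2)) \<partial>lborel)"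
proof -
  have [measurable]: "(\<lambda>t. \<integral>\<^sup>+\<theta>. h \<theta> \<partial>normal_law 0 (t * \<tau>\<^sup>2)) \<in> borel_measurable borel"
    by (rule measurable_compose[OF normal_law_scaled_measurable nn_integral_measurable_subprob_algebra]) simp
  show ?thesis
    unfolding scaled_normal_mixture_def
    by (subst nn_integral_bind[where B = borel]) (auto simp: nn_integral_density)
qed

lemma prob_space_scaled_normal_mixture:
  assumes "is_prob_density f"
  shows "prob_space (scaled_normal_mixture f \<tau>)"
proof (rule prob_spaceI)
  note [measurable] = assms[unfolded is_prob_density_def, THEN conjunct1]
  have "emeasure (scaled_normal_mixture f \<tau>) (space (scaled_normal_mixture f \<tau>))
      = (\<integral>\<^sup>+\<theta>. 1 \<partial>scaled_normal_mixture f \<tau>)"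
    by simp
  also have "\<dots> = (\<integral>\<^sup>+t. ennreal (f t) * 1 \<partial>lborel)"
    using prob_space.emeasure_space_1[OF prob_space_normal_law]
    by (subst nn_integral_scaled_normal_mixture) auto
  also have "\<dots> = 1" using assms by (simp add: is_prob_density_def)
  finally show "emeasure (scaled_normal_mixture f \<tau>) (space (scaled_normal_mixture f \<tau>)) = 1" .
qed

definition evidence :: "real measure \<Rightarrow> real \<Rightarrow> ennreal" where
  "evidence G x = (\<integral>\<^sup>+\<theta>. ennreal (normal_density \<theta> 1 x) \<partial>G)"

definition sq_error_integral :: "real measure \<Rightarrow> real \<Rightarrow> real \<Rightarrow> ennreal" where
  "sq_error_integral G m x = (\<integral>\<^sup>+\<theta>. ennreal ((\<theta> - m)\<^sup>2 * normal_density \<theta> 1 x) \<partial>G)"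

lemma evidence_scaled_normal_mixture:
  assumes f: "f \<in> borel_measurable borel" "\<forall>t\<le>0. f t = 0" and \<tau>: "0 < \<tau>"
  shows "evidence (scaled_normal_mixture f \<tau>) x
       = (\<integral>\<^sup>+t. ennreal (f t) * ennreal (normal_density 0 (sqrt (1 + t * \<tau>\<^sup>2)) x) \<partial>lborel)"
proof -
  show ?thesis
    unfolding evidence_def using f(1)
  proof (subst nn_integral_scaled_normal_mixture, simp, simp, intro nn_integral_cong)
    fix t
    show "ennreal (f t) * (\<integral>\<^sup>+\<theta>. ennreal (normal_density \<theta> 1 x) \<partial>normal_law 0 (t * \<tau>\<^sup>2))
        = ennreal (f t) * ennreal (normal_density 0 (sqrt (1 + t * \<tau>\<^sup>2)) x)"
      using f(2)[rule_format, of t] \<tau> by (cases "t \<le> 0") (auto simp: nn_integral_conjugate_evidence)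
  qed
qed

lemma sq_error_integral_scaled_normal_mixture:
  assumes f: "f \<in> borel_measurable borel" "\<forall>t\<le>0. f t = 0" and \<tau>: "0 < \<tau>"
  shows "sq_error_integral (scaled_normal_mixture f \<tau>) m x
       = (\<integral>\<^sup>+t. ennreal (f t) * ennreal (normal_density 0 (sqrt (1 + t * \<tau>\<^sup>2)) x *
            (t * \<tau>\<^sup>2 / (1 + t * \<tau>\<^sup>2) + (t * \<tau>\<^sup>2 / (1 + t * \<tau>\<^sup>2) * x - m)\<^sup>2)) \<partial>lborel)"
proof -
  show ?thesis
    unfolding sq_error_integral_def using f(1)
  proof (subst nn_integral_scaled_normal_mixture, simp, simp, intro nn_integral_cong)
    fix t
    show "ennreal (f t) * (\<integral>\<^sup>+\<theta>. ennreal ((\<theta> - m)\<^sup>2 * normal_density \<theta> 1 x) \<partial>normal_law 0 (t * \<tau>\<^sup>2))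
        = ennreal (f t) * ennreal (normal_density 0 (sqrt (1 + t * \<tau>\<^sup>2)) x *
            (t * \<tau>\<^sup>2 / (1 + t * \<tau>\<^sup>2) + (t * \<tau>\<^sup>2 / (1 + t * \<tau>\<^sup>2) * x - m)\<^sup>2))"
      using f(2)[rule_format, of t] \<tau> by (cases "t \<le> 0") (auto simp: nn_integral_conjugate_moment)
  qed
qed

section \<open>Reduction to one coordinate\<close>

lemma evidence_less_top:
  assumes "prob_space G" "sets G = sets borel"
  shows "evidence G x < \<top>"
proof -
  interpret prob_space G by fact
  have le: "normal_density \<theta> 1 x \<le> 1" for \<theta>
  proof -
    have "1 / sqrt (2 * pi) * exp (- (x - \<theta>)\<^sup>2 / 2) \<le> 1 * 1"
      using pi_gt3 by (intro mult_mono) auto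
    then show ?thesis by (simp add: normal_density_def)
  qed
  have "evidence G x \<le> (\<integral>\<^sup>+\<theta>. 1 \<partial>G)"
    unfolding evidence_def by (intro nn_integral_mono) (auto simp: le)
  also have "\<dots> = 1" by (simp add: emeasure_space_1)
  finally show ?thesis by (auto simp: less_top[symmetric] top_unique)
qed

lemma evidence_pos:
  assumes "prob_space G" and [measurable_cong]: "sets G = sets borel"
  shows "0 < evidence G x"
proof (rule ccontr)
  interpret prob_space G by fact
  assume "\<not> 0 < evidence G x"
  then have "AE \<theta> in G. ennreal (normal_density \<theta> 1 x) = 0"
    unfolding evidence_def by (subst (asm) not_gr_zero, subst (asm) nn_integral_0_iff_AE) auto
  then have "AE \<theta> in G. False"
  proof eventually_elim
    case (elim \<theta>)
    moreover have "0 < normal_density \<theta> 1 x" by (rule normal_density_pos) simp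
    ultimately show ?case by (simp add: ennreal_eq_0_iff)
  qed
  then show False by (simp add: AE_False emeasure_space_1)
qed

lemma evidence_measurable [measurable]:
  assumes "prob_space G" and [measurable_cong]: "sets G = sets borel"
  shows "evidence G \<in> borel_measurable borel"
proof -
  interpret prob_space G by fact
  show ?thesis unfolding evidence_def[abs_def] normal_density_def by measurable
qed

lemma sq_error_integral_measurable [measurable]:
  assumes "prob_space G" and [measurable_cong]: "sets G = sets borel"
  shows "sq_error_integral G m \<in> borel_measurable borel"
proof -
  interpret prob_space G by fact
  show ?thesis unfolding sq_error_integral_def[abs_def] normal_density_def by measurable
qed

definition iid_prior :: "nat \<Rightarrow> real measure \<Rightarrow> (nat \<Rightarrow> real) measure" where
  "iid_prior n G = (\<Pi>\<^sub>M i\<in>{..<n}. G)"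

lemma sets_iid_prior:
  "sets G = sets borel \<Longrightarrow> sets (iid_prior n G) = sets (\<Pi>\<^sub>M i\<in>{..<n}. borel)"
  unfolding iid_prior_def by (intro sets_PiM_cong) auto

lemma space_iid_prior:
  "sets G = sets borel \<Longrightarrow> space (iid_prior n G) = real_vectors n"
  using sets_eq_imp_space_eq[OF sets_iid_prior, of G n]
  by (simp add: space_PiM real_vectors_def)

lemma likelihood_measurable [measurable]:
  "(\<lambda>\<theta>. likelihood n \<theta> x) \<in> borel_measurable (\<Pi>\<^sub>M i\<in>{..<n}. borel)"
  unfolding likelihood_def normal_density_def by measurable

lemma likelihood_eq: "ennreal (likelihood n \<theta> x) = (\<Prod>i<n. ennreal (normal_density (\<theta> i) 1 (x i)))"
  unfolding likelihood_def by (simp add: prod_ennreal)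

lemma nn_integral_likelihood:
  assumes "prob_space G" and [measurable_cong]: "sets G = sets borel"
  shows "(\<integral>\<^sup>+\<theta>. ennreal (likelihood n \<theta> x) \<partial>iid_prior n G) = (\<Prod>i<n. evidence G (x i))"
proof -
  interpret product_sigma_finite "\<lambda>_::nat. G"
    using assms(1) by (simp add: product_sigma_finite_def prob_space_imp_sigma_finite)
  show ?thesis
    unfolding iid_prior_def likelihood_eq evidence_def
    by (subst product_nn_integral_prod) auto
qed

text \<open>The extra factor involves only coordinate \<open>i\<close>, so the integral still is a product over the
  coordinates.\<close>

lemma nn_integral_sq_error_likelihood:
  assumes "prob_space G" and [measurable_cong]: "sets G = sets borel" and i: "i < n"
  shows "(\<integral>\<^sup>+\<theta>. ennreal (likelihood n \<theta> x) * ennreal ((\<theta> i - m)\<^sup>2) \<partial>iid_prior n G)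
       = sq_error_integral G m (x i) * (\<Prod>j\<in>{..<n} - {i}. evidence G (x j))"
proof -
  interpret product_sigma_finite "\<lambda>_::nat. G"
    using assms(1) by (simp add: product_sigma_finite_def prob_space_imp_sigma_finite)
  let ?h = "\<lambda>j \<theta>. if j = i then ennreal ((\<theta> - m)\<^sup>2 * normal_density \<theta> 1 (x j))
    else ennreal (normal_density \<theta> 1 (x j))"
  have eq: "ennreal (likelihood n \<theta> x) * ennreal ((\<theta> i - m)\<^sup>2) = (\<Prod>j<n. ?h j (\<theta> j))" for \<theta>
    using i unfolding likelihood_eq
    by (simp add: prod.remove[of "{..<n}" i] ennreal_mult' ac_simps)
  have "(\<integral>\<^sup>+\<theta>. ennreal (likelihood n \<theta> x) * ennreal ((\<theta> i - m)\<^sup>2) \<partial>iid_prior n G)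
      = (\<Prod>j<n. \<integral>\<^sup>+\<theta>. ?h j \<theta> \<partial>G)"
    unfolding eq iid_prior_def by (subst product_nn_integral_prod) auto
  also have "\<dots> = (\<Prod>j<n. if j = i then sq_error_integral G m (x j) else evidence G (x j))"
    by (intro prod.cong) (auto simp: sq_error_integral_def evidence_def)
  also have "\<dots> = sq_error_integral G m (x i) * (\<Prod>j\<in>{..<n} - {i}. evidence G (x j))"
    using i by (simp add: prod.remove[of "{..<n}" i])
  finally show ?thesis .
qed

lemma prod_evidence_pos_less_top:
  assumes "prob_space G" "sets G = sets borel" "finite I"
  shows "0 < (\<Prod>i\<in>I. evidence G (x i))" "(\<Prod>i\<in>I. evidence G (x i)) < \<top>"
  using assms(3) evidence_pos[OF assms(1,2)] evidence_less_top[OF assms(1,2)]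
  by (induction I rule: finite_induct) (auto simp: ennreal_zero_less_mult_iff ennreal_mult_less_top)

lemma sets_posterior [simp]: "sets (posterior n P x) = sets P"
  by (simp add: posterior_def)

lemma space_posterior [simp]: "space (posterior n P x) = space P"
  by (simp add: posterior_def)

lemma prob_space_posterior:
  assumes G: "prob_space G" "sets G = sets borel"
  shows "prob_space (posterior n (iid_prior n G) x)"
proof (rule prob_spaceI)
  note [measurable_cong] = sets_iid_prior[OF G(2)]
  let ?Z = "\<integral>\<^sup>+\<eta>. ennreal (likelihood n \<eta> x) \<partial>iid_prior n G"
  have Z: "0 < ?Z" "?Z < \<top>"
    using prod_evidence_pos_less_top[OF G, of "{..<n}" x] by (simp_all add: nn_integral_likelihood[OF G])
  have "emeasure (posterior n (iid_prior n G) x) (space (posterior n (iid_prior n G) x))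
      = (\<integral>\<^sup>+\<theta>. 1 \<partial>posterior n (iid_prior n G) x)" by simp
  also have "\<dots> = ?Z / ?Z"
    unfolding posterior_def by (subst nn_integral_density) (auto simp: nn_integral_divide)
  also have "\<dots> = 1" using Z by (intro ennreal_divide_self) auto
  finally show "emeasure (posterior n (iid_prior n G) x) (space (posterior n (iid_prior n G) x)) = 1" .
qed

text \<open>Likelihood and prior both factorise, so the other coordinates cancel from Bayes' formula.\<close>

lemma posterior_coordinate_sq_error:
  assumes G: "prob_space G" "sets G = sets borel" and i: "i < n"
  shows "(\<integral>\<^sup>+\<theta>. ennreal ((\<theta> i - m)\<^sup>2) \<partial>posterior n (iid_prior n G) x)
       = sq_error_integral G m (x i) / evidence G (x i)"
proof -
  note [measurable_cong] = sets_iid_prior[OF G(2)]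
  note i[simp]
  let ?Z = "\<integral>\<^sup>+\<eta>. ennreal (likelihood n \<eta> x) \<partial>iid_prior n G"
  let ?R = "\<Prod>j\<in>{..<n} - {i}. evidence G (x j)"
  have [measurable]: "(\<lambda>\<theta>. ennreal ((\<theta> i - m)\<^sup>2)) \<in> borel_measurable (\<Pi>\<^sub>M i\<in>{..<n}. borel)"
    by measurable
  have "(\<integral>\<^sup>+\<theta>. ennreal ((\<theta> i - m)\<^sup>2) \<partial>posterior n (iid_prior n G) x)
      = (\<integral>\<^sup>+\<theta>. ennreal (likelihood n \<theta> x) * ennreal ((\<theta> i - m)\<^sup>2) / ?Z \<partial>iid_prior n G)"
    unfolding posterior_def
    by (subst nn_integral_density) (auto intro!: nn_integral_cong simp: divide_ennreal_def ac_simps)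
  also have "\<dots> = sq_error_integral G m (x i) * ?R / ?Z"
    by (subst nn_integral_divide) (auto simp: nn_integral_sq_error_likelihood[OF G i])
  also have "?Z = evidence G (x i) * ?R"
    by (simp add: nn_integral_likelihood[OF G] prod.remove[of "{..<n}" i])
  finally have "(\<integral>\<^sup>+\<theta>. ennreal ((\<theta> i - m)\<^sup>2) \<partial>posterior n (iid_prior n G) x)
      = sq_error_integral G m (x i) * ?R / (evidence G (x i) * ?R)" .
  moreover have "?R \<noteq> 0" "?R \<noteq> \<infinity>"
    using prod_evidence_pos_less_top[OF G, of "{..<n} - {i}" x]
    by (metis finite_Diff finite_lessThan less_irrefl infinity_ennreal_def)+
  ultimately show ?thesis by (metis divide_mult_eq)
qed

lemma sq_dist_eq_sum: "sq_dist n \<theta> \<eta> = (\<Sum>i<n. (\<theta> i - \<eta> i)\<^sup>2)"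
  by (simp add: sq_dist_def L2_set_def sum_nonneg)

lemma ennreal_sq_dist: "ennreal (sq_dist n \<theta> \<eta>) = (\<Sum>i<n. ennreal ((\<theta> i - \<eta> i)\<^sup>2))"
  by (simp add: sq_dist_eq_sum)

lemma sq_dist_measurable [measurable]:
  "(\<lambda>\<theta>. sq_dist n \<theta> \<eta>) \<in> borel_measurable (\<Pi>\<^sub>M i\<in>{..<n}. borel)"
  unfolding sq_dist_eq_sum by measurable

definition coordinate_loss :: "real measure \<Rightarrow> real \<Rightarrow> real \<Rightarrow> ennreal" where
  "coordinate_loss G m x = sq_error_integral G m x / evidence G x"

definition coordinate_risk :: "real measure \<Rightarrow> real \<Rightarrow> ennreal" where
  "coordinate_risk G m = (\<integral>\<^sup>+x. coordinate_loss G m x \<partial>normal_law m 1)"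

lemma coordinate_loss_measurable [measurable]:
  assumes "prob_space G" "sets G = sets borel"
  shows "coordinate_loss G m \<in> borel_measurable borel"
proof -
  note [measurable] = evidence_measurable[OF assms] sq_error_integral_measurable[OF assms]
  show ?thesis unfolding coordinate_loss_def[abs_def] by measurable
qed

lemma posterior_sq_dist:
  assumes G: "prob_space G" "sets G = sets borel"
  shows "(\<integral>\<^sup>+\<theta>. ennreal (sq_dist n \<theta> \<eta>) \<partial>posterior n (iid_prior n G) x)
       = (\<Sum>i<n. coordinate_loss G (\<eta> i) (x i))"
proof -
  have [measurable_cong]: "sets (posterior n (iid_prior n G) x) = sets (\<Pi>\<^sub>M i\<in>{..<n}. borel)"
    using sets_iid_prior[OF G(2)] by simp
  show ?thesis
    unfolding ennreal_sq_dist
    by (subst nn_integral_sum) (auto simp: posterior_coordinate_sq_error[OF G] coordinate_loss_def)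
qed

lemma sets_gaussian_model [measurable_cong]:
  "sets (gaussian_model n \<eta>) = sets (\<Pi>\<^sub>M i\<in>{..<n}. borel)"
  unfolding gaussian_model_def by (intro sets_PiM_cong) auto

lemma nn_integral_gaussian_model_component:
  assumes i: "i < n" and [measurable]: "h \<in> borel_measurable borel"
  shows "(\<integral>\<^sup>+x. h (x i) \<partial>gaussian_model n \<eta>) = (\<integral>\<^sup>+x. h x \<partial>normal_law (\<eta> i) 1)"
proof -
  interpret product_prob_space "\<lambda>i. normal_law (\<eta> i) 1" "{..<n}"
    by (intro product_prob_spaceI prob_space_normal_law)
  have "(\<integral>\<^sup>+x. h x \<partial>normal_law (\<eta> i) 1)
      = (\<integral>\<^sup>+x. h x \<partial>distr (gaussian_model n \<eta>) (normal_law (\<eta> i) 1) (\<lambda>\<omega>. \<omega> i))"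
    unfolding gaussian_model_def using i by (subst PiM_component) auto
  also have "\<dots> = (\<integral>\<^sup>+x. h (x i) \<partial>gaussian_model n \<eta>)"
    using i by (subst nn_integral_distr) auto
  finally show ?thesis by simp
qed

lemma expected_posterior_sq_dist:
  assumes G: "prob_space G" "sets G = sets borel"
  shows "(\<integral>\<^sup>+x. (\<integral>\<^sup>+\<theta>. ennreal (sq_dist n \<theta> \<eta>) \<partial>posterior n (iid_prior n G) x) \<partial>gaussian_model n \<eta>)
       = (\<Sum>i<n. coordinate_risk G (\<eta> i))"
proof -
  note [measurable] = coordinate_loss_measurable[OF G]
  have "(\<integral>\<^sup>+x. (\<Sum>i<n. coordinate_loss G (\<eta> i) (x i)) \<partial>gaussian_model n \<eta>)
      = (\<Sum>i<n. \<integral>\<^sup>+x. coordinate_loss G (\<eta> i) (x i) \<partial>gaussian_model n \<eta>)"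
    by (intro nn_integral_sum) measurable
  also have "\<dots> = (\<Sum>i<n. coordinate_risk G (\<eta> i))"
    by (intro sum.cong) (auto simp: nn_integral_gaussian_model_component coordinate_risk_def)
  finally show ?thesis by (simp add: posterior_sq_dist[OF G])
qed

lemma expected_posterior_mass_outside_le:
  assumes G: "prob_space G" "sets G = sets borel" and r: "0 < r"
  shows "expected_posterior_mass_outside n (iid_prior n G) \<eta> r
       \<le> (\<Sum>i<n. coordinate_risk G (\<eta> i)) / ennreal r"
proof -
  note [measurable] = coordinate_loss_measurable[OF G]
  let ?\<Pi> = "\<lambda>x. posterior n (iid_prior n G) x"
  have Markov: "emeasure (?\<Pi> x) {\<theta> \<in> real_vectors n. sq_dist n \<theta> \<eta> > r}
      \<le> (\<integral>\<^sup>+\<theta>. ennreal (sq_dist n \<theta> \<eta>) \<partial>?\<Pi> x) / ennreal r" for x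
  proof -
    have [measurable_cong]: "sets (?\<Pi> x) = sets (\<Pi>\<^sub>M i\<in>{..<n}. borel)"
      using sets_iid_prior[OF G(2)] by simp
    have "emeasure (?\<Pi> x) {\<theta> \<in> real_vectors n. sq_dist n \<theta> \<eta> > r}
        \<le> emeasure (?\<Pi> x) {\<theta> \<in> space (?\<Pi> x). 1 \<le> ennreal (1 / r) * ennreal (sq_dist n \<theta> \<eta>)}"
    proof (rule emeasure_mono)
      show "{\<theta> \<in> real_vectors n. sq_dist n \<theta> \<eta> > r}
          \<subseteq> {\<theta> \<in> space (?\<Pi> x). 1 \<le> ennreal (1 / r) * ennreal (sq_dist n \<theta> \<eta>)}"
        using r by (auto simp: space_iid_prior[OF G(2)] ennreal_mult'[symmetric])
    qed measurable
    also have "\<dots> \<le> ennreal (1 / r) * (\<integral>\<^sup>+\<theta>. ennreal (sq_dist n \<theta> \<eta>) * indicator (space (?\<Pi> x)) \<theta> \<partial>?\<Pi> x)"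
      by (intro nn_integral_Markov_inequality) measurable
    also have "\<dots> = (\<integral>\<^sup>+\<theta>. ennreal (sq_dist n \<theta> \<eta>) \<partial>?\<Pi> x) / ennreal r"
      using r by (simp add: divide_ennreal_def inverse_ennreal mult.commute inverse_eq_divide
          cong: nn_integral_cong_simp)
    finally show ?thesis .
  qed
  have "expected_posterior_mass_outside n (iid_prior n G) \<eta> r
      \<le> (\<integral>\<^sup>+x. (\<integral>\<^sup>+\<theta>. ennreal (sq_dist n \<theta> \<eta>) \<partial>?\<Pi> x) / ennreal r \<partial>gaussian_model n \<eta>)"
    unfolding expected_posterior_mass_outside_def by (intro nn_integral_mono Markov)
  also have "\<dots> = (\<integral>\<^sup>+x. (\<integral>\<^sup>+\<theta>. ennreal (sq_dist n \<theta> \<eta>) \<partial>?\<Pi> x) \<partial>gaussian_model n \<eta>) / ennreal r"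
    unfolding posterior_sq_dist[OF G] by (intro nn_integral_divide) measurable
  finally show ?thesis by (simp add: expected_posterior_sq_dist[OF G])
qed

text \<open>Jensen's inequality for the square. If the right-hand side is infinite there is nothing to show;
  otherwise \<open>f\<close> is integrable and its variance is nonnegative.\<close>

lemma posterior_mean_sq_error_le:
  assumes P: "prob_space P" and f: "f \<in> borel_measurable P"
  shows "ennreal (((\<integral>\<theta>. f \<theta> \<partial>P) - m)\<^sup>2) \<le> (\<integral>\<^sup>+\<theta>. ennreal ((f \<theta> - m)\<^sup>2) \<partial>P)"
proof (cases "(\<integral>\<^sup>+\<theta>. ennreal ((f \<theta> - m)\<^sup>2) \<partial>P) = \<top>")
  case False
  interpret prob_space P by fact
  note f[measurable]
  have sq: "integrable P (\<lambda>\<theta>. (f \<theta> - m)\<^sup>2)"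
    using False by (intro integrableI_nonneg) (auto simp: less_top)
  have "integrable P (\<lambda>\<theta>. f \<theta> - m)"
    by (rule square_integrable_imp_integrable[OF _ sq]) measurable
  then have int: "integrable P f"
    using Bochner_Integration.integrable_add[of P "\<lambda>\<theta>. f \<theta> - m" "\<lambda>_. m"] by simp
  have "((\<integral>\<theta>. f \<theta> \<partial>P) - m)\<^sup>2 = (\<integral>\<theta>. f \<theta> - m \<partial>P)\<^sup>2"
    using int by (simp add: prob_space)
  also have "\<dots> \<le> (\<integral>\<theta>. (f \<theta> - m)\<^sup>2 \<partial>P)"
    using variance_eq[of "\<lambda>\<theta>. f \<theta> - m"] variance_positive[of "\<lambda>\<theta>. f \<theta> - m"] int sq by simp
  finally show ?thesis
    using sq by (subst nn_integral_eq_integral) (auto simp: ennreal_leI)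
qed simp

lemma posterior_mean_risk_le:
  assumes G: "prob_space G" "sets G = sets borel"
  shows "posterior_mean_risk n (iid_prior n G) \<eta> \<le> (\<Sum>i<n. coordinate_risk G (\<eta> i))"
proof -
  let ?\<Pi> = "\<lambda>x. posterior n (iid_prior n G) x"
  have "ennreal (sq_dist n (posterior_mean n (iid_prior n G) x) \<eta>)
      \<le> (\<integral>\<^sup>+\<theta>. ennreal (sq_dist n \<theta> \<eta>) \<partial>?\<Pi> x)" for x
  proof -
    have [measurable_cong]: "sets (?\<Pi> x) = sets (\<Pi>\<^sub>M i\<in>{..<n}. borel)"
      using sets_iid_prior[OF G(2)] by simp
    have "ennreal (sq_dist n (posterior_mean n (iid_prior n G) x) \<eta>)
        \<le> (\<Sum>i<n. \<integral>\<^sup>+\<theta>. ennreal ((\<theta> i - \<eta> i)\<^sup>2) \<partial>?\<Pi> x)"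
      unfolding ennreal_sq_dist posterior_mean_def
      using posterior_mean_sq_error_le[OF prob_space_posterior[OF G]] by (intro sum_mono) auto
    also have "\<dots> = (\<integral>\<^sup>+\<theta>. ennreal (sq_dist n \<theta> \<eta>) \<partial>?\<Pi> x)"
      unfolding ennreal_sq_dist by (intro nn_integral_sum[symmetric]) auto
    finally show ?thesis .
  qed
  then show ?thesis
    unfolding posterior_mean_risk_def expected_posterior_sq_dist[OF G, symmetric]
    by (intro nn_integral_mono)
qed

lemma sum_coordinate_risk_sparse_le:
  assumes \<eta>: "\<eta> \<in> sparse_vectors n p" and p: "0 \<le> p"
    and AB: "0 \<le> A" "0 \<le> B"
    and zero: "coordinate_risk G 0 \<le> ennreal A"
    and nonzero: "\<And>m. coordinate_risk G m \<le> ennreal B"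
  shows "(\<Sum>i<n. coordinate_risk G (\<eta> i)) \<le> ennreal (real n * A + p * B)"
proof -
  have "(\<Sum>i<n. coordinate_risk G (\<eta> i)) \<le> (\<Sum>i<n. ennreal (A + of_bool (\<eta> i \<noteq> 0) * B))"
    using zero nonzero AB by (intro sum_mono) (auto simp: add_increasing)
  also have "\<dots> = ennreal (\<Sum>i<n. A + of_bool (\<eta> i \<noteq> 0) * B)"
    using AB by (intro sum_ennreal) auto
  also have "(\<Sum>i<n. A + of_bool (\<eta> i \<noteq> 0) * B) = real n * A + (\<Sum>i<n. of_bool (\<eta> i \<noteq> 0)) * B"
    by (simp add: sum.distrib sum_distrib_right)
  also have "\<dots> \<le> real n * A + p * B"
    using \<eta> AB by (intro add_mono mult_right_mono) (auto simp: sparse_vectors_def)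
  finally show ?thesis using ennreal_leI by blast
qed

section \<open>Posterior spread about the observation\<close>

text \<open>Powers of the observation are traded for a small part of the exponential decay; the inequality is
  \<open>ln z \<le> z - 1\<close> at \<open>z = y / (4 * b)\<close>.\<close>

lemma powr_le_exp_quarter:
  fixes y b :: real
  assumes "0 < y" "0 < b"
  shows "y powr b \<le> (4 * b) powr b * exp (y / 4)"
proof -
  have "ln (y / (4 * b)) \<le> y / (4 * b) - 1"
    using assms by (intro ln_le_minus_one) auto
  then have "ln y \<le> y / (4 * b) + ln (4 * b)"
    using assms by (simp add: ln_div)
  then have "b * ln y \<le> b * (y / (4 * b) + ln (4 * b))"
    using assms by (intro mult_left_mono) auto
  also have "\<dots> = b * ln (4 * b) + y / 4"
    using assms by (simp add: field_simps)
  finally have "exp (b * ln y) \<le> exp (b * ln (4 * b) + y / 4)" by simp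
  then show ?thesis using assms by (simp add: powr_def exp_add)
qed

lemma is_prob_density_measurable:
  "is_prob_density f \<Longrightarrow> f \<in> borel_measurable borel"
  by (simp add: is_prob_density_def)

lemma power_mixing_density_nonpos: "t \<le> 0 \<Longrightarrow> power_mixing_density K a L t = 0"
  by (simp add: power_mixing_density_def)

lemma normal_density_scale_lower:
  fixes x u :: real
  assumes "1 \<le> x\<^sup>2" "x\<^sup>2 \<le> u" "u \<le> 3 * x\<^sup>2"
  shows "exp (- (1 / 2)) / sqrt (6 * pi) / \<bar>x\<bar> \<le> normal_density 0 (sqrt u) x"
proof -
  have u: "0 < u" using assms by linarith
  have x: "0 < \<bar>x\<bar>" using assms by auto
  have "sqrt (2 * pi * u) \<le> sqrt (6 * pi * x\<^sup>2)"
    using assms by (intro real_sqrt_le_mono) simp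
  also have "\<dots> = sqrt (6 * pi) * \<bar>x\<bar>" by (simp add: real_sqrt_mult)
  finally have 1: "1 / (sqrt (6 * pi) * \<bar>x\<bar>) \<le> 1 / sqrt (2 * pi * u)"
    using x u by (intro divide_left_mono) auto
  have 2: "exp (- (1 / 2)) \<le> exp (- x\<^sup>2 / (2 * u))"
    using assms u by (simp add: field_simps)
  have "1 / (sqrt (6 * pi) * \<bar>x\<bar>) * exp (- (1 / 2)) \<le> 1 / sqrt (2 * pi * u) * exp (- x\<^sup>2 / (2 * u))"
    using 1 2 u by (intro mult_mono) auto
  then show ?thesis using u by (simp add: normal_density_def)
qed

text \<open>Heavy tails: only the variances between \<open>x\<^sup>2\<close> and \<open>2 * x\<^sup>2\<close> are kept. There the
  normal density at \<open>x\<close> is of order \<open>1 / \<bar>x\<bar>\<close>, and the mixing density gives these variances a mass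
  of order \<open>(x\<^sup>2 / \<tau>\<^sup>2) powr (- a)\<close>.\<close>

lemma evidence_tail_lower:
  fixes K a c0 t0 \<tau> x :: real and L :: "real \<Rightarrow> real"
  assumes dens: "is_prob_density (power_mixing_density K a L)"
    and pos: "0 < K" "0 < a" "0 < c0" "0 < t0" and \<tau>: "0 < \<tau>" "\<tau> \<le> 1"
    and L_lower: "\<forall>t\<ge>t0. c0 < L t" and x: "1 \<le> x\<^sup>2" "t0 \<le> x\<^sup>2"
  defines "c \<equiv> K * c0 * 2 powr (- (a + 1)) * (exp (- (1 / 2)) / sqrt (6 * pi))"
  shows "ennreal (c * \<tau> powr (2 * a) * \<bar>x\<bar> powr (- (2 * a + 1)))
       \<le> evidence (scaled_normal_mixture (power_mixing_density K a L) \<tau>) x"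
proof -
  define y where "y = x\<^sup>2 / \<tau>\<^sup>2"
  have x0: "0 < \<bar>x\<bar>" using x by auto
  have \<tau>2: "0 < \<tau>\<^sup>2" "\<tau>\<^sup>2 \<le> 1" using \<tau> by (auto simp: power_le_one)
  have y: "0 < y" "x\<^sup>2 \<le> y"
    using \<tau>2 x x0 by (auto simp: y_def field_simps mult_left_le)
  have y\<tau>: "y * \<tau>\<^sup>2 = x\<^sup>2" using \<tau>2 by (simp add: y_def)
  let ?e = "exp (- (1 / 2)) / sqrt (6 * pi) / \<bar>x\<bar>"
  define q where "q = K * (2 * y) powr (- (a + 1)) * c0 * ?e"
  have q: "0 \<le> q" using pos by (simp add: q_def)
  have "ennreal (q * y) = ennreal q * ennreal (2 * y - y)"
    using q by (simp add: ennreal_mult')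
  also have "\<dots> = ennreal q * emeasure lborel {y..2*y}"
    using y by simp
  also have "\<dots> = (\<integral>\<^sup>+t. ennreal q * indicator {y..2*y} t \<partial>lborel)"
    by (simp add: nn_integral_cmult_indicator)
  also have "\<dots> \<le> (\<integral>\<^sup>+t. ennreal (power_mixing_density K a L t) *
      ennreal (normal_density 0 (sqrt (1 + t * \<tau>\<^sup>2)) x) \<partial>lborel)"
  proof (intro nn_integral_mono)
    fix t
    show "ennreal q * indicator {y..2*y} t \<le> ennreal (power_mixing_density K a L t) *
      ennreal (normal_density 0 (sqrt (1 + t * \<tau>\<^sup>2)) x)"
    proof (cases "t \<in> {y..2*y}")
      case True
      then have t: "y \<le> t" "t \<le> 2 * y" by auto
      have "y * \<tau>\<^sup>2 \<le> t * \<tau>\<^sup>2" "t * \<tau>\<^sup>2 \<le> 2 * y * \<tau>\<^sup>2"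
        using t by (auto intro!: mult_right_mono)
      then have u: "x\<^sup>2 \<le> 1 + t * \<tau>\<^sup>2" "1 + t * \<tau>\<^sup>2 \<le> 3 * x\<^sup>2"
        using y\<tau> x by auto
      have "K * (2 * y) powr (- (a + 1)) * c0 \<le> K * t powr (- (a + 1)) * L t"
        using t y pos x L_lower[rule_format, of t]
        by (intro mult_mono powr_mono2') auto
      then have "q \<le> power_mixing_density K a L t * normal_density 0 (sqrt (1 + t * \<tau>\<^sup>2)) x"
        using t y pos x L_lower[rule_format, of t] normal_density_scale_lower[OF x(1) u]
        unfolding q_def by (intro mult_mono) (auto simp: power_mixing_density_def)
      moreover have "0 \<le> power_mixing_density K a L t"
        using dens by (simp add: is_prob_density_def)
      ultimately show ?thesis
        using True by (simp add: ennreal_mult'[symmetric] ennreal_leI)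
    qed simp
  qed
  also have "\<dots> = evidence (scaled_normal_mixture (power_mixing_density K a L) \<tau>) x"
    using \<tau>(1) dens
    by (intro evidence_scaled_normal_mixture[symmetric]) (auto simp: power_mixing_density_nonpos is_prob_density_measurable)
  finally have main: "ennreal (q * y) \<le> evidence (scaled_normal_mixture (power_mixing_density K a L) \<tau>) x" .
  have "y powr (- a) = \<bar>x\<bar> powr (- (2 * a)) * \<tau> powr (2 * a)"
  proof -
    have "y = (\<bar>x\<bar> / \<tau>) powr 2"
      using x0 \<tau> by (simp add: y_def power_divide powr_numeral)
    then have "y powr (- a) = (\<bar>x\<bar> / \<tau>) powr (- (2 * a))"
      by (simp add: powr_powr)
    also have "\<dots> = \<bar>x\<bar> powr (- (2 * a)) * \<tau> powr (2 * a)"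
      using x0 \<tau> by (simp add: powr_divide powr_minus field_simps)
    finally show ?thesis .
  qed
  moreover have "(2 * y) powr (- (a + 1)) * y = 2 powr (- (a + 1)) * y powr (- a)"
    using y powr_add[of y "- (a + 1)" 1] by (simp add: powr_mult)
  moreover have "\<bar>x\<bar> powr (- (2 * a + 1)) = \<bar>x\<bar> powr (- (2 * a)) / \<bar>x\<bar>"
    using x0 powr_add[of "\<bar>x\<bar>" "- (2 * a)" "-1"] by (simp add: powr_minus_divide)
  ultimately have "q * y = c * \<tau> powr (2 * a) * \<bar>x\<bar> powr (- (2 * a + 1))"
    by (simp add: c_def q_def)
  then show ?thesis using main by simp
qed

text \<open>The quantity \<open>x / u\<close> is the distance by which a prior variance \<open>u - 1\<close> shrinks \<open>x\<close>. Either it is at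
  most \<open>w\<close>, or the normal density with variance \<open>u\<close> has exponent \<open>x\<^sup>2 / (2 * u) > \<bar>x\<bar> * w / 2\<close>.\<close>

lemma shrinkage_tradeoff:
  fixes u x w :: real
  assumes u: "1 \<le> u" and w: "0 < w"
  shows "normal_density 0 (sqrt u) x * (x / u)\<^sup>2
       \<le> w\<^sup>2 * normal_density 0 (sqrt u) x + x\<^sup>2 * exp (- (\<bar>x\<bar> * w / 2))"
proof (cases "\<bar>x\<bar> / u \<le> w")
  case True
  then have "(\<bar>x\<bar> / u)\<^sup>2 \<le> w\<^sup>2" using u by (intro power_mono) auto
  then have "(x / u)\<^sup>2 \<le> w\<^sup>2" by (simp add: power_divide)
  then have "normal_density 0 (sqrt u) x * (x / u)\<^sup>2 \<le> normal_density 0 (sqrt u) x * w\<^sup>2"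
    by (intro mult_left_mono) auto
  then show ?thesis by (simp add: mult.commute add_increasing2)
next
  case False
  have "w * \<bar>x\<bar> \<le> \<bar>x\<bar> / u * \<bar>x\<bar>"
    using False by (intro mult_right_mono) auto
  then have "w * \<bar>x\<bar> \<le> x\<^sup>2 / u"
    by (simp add: power2_eq_square flip: abs_mult)
  then have "exp (- x\<^sup>2 / (2 * u)) \<le> exp (- (\<bar>x\<bar> * w / 2))"
    by (simp add: mult.commute)
  moreover have "1 / sqrt (2 * pi * u) \<le> 1"
  proof -
    have "1 * 1 \<le> (2 * pi) * u" using pi_gt3 u by (intro mult_mono) auto
    then show ?thesis by simp
  qed
  ultimately have "1 / sqrt (2 * pi * u) * exp (- x\<^sup>2 / (2 * u)) \<le> 1 * exp (- (\<bar>x\<bar> * w / 2))"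
    using u by (intro mult_mono) auto
  then have n: "normal_density 0 (sqrt u) x \<le> exp (- (\<bar>x\<bar> * w / 2))"
    using u by (simp add: normal_density_def)
  have "(x / u)\<^sup>2 \<le> x\<^sup>2"
    using u by (simp add: power_divide divide_le_eq mult_le_cancel_left1) 
  then have "normal_density 0 (sqrt u) x * (x / u)\<^sup>2 \<le> exp (- (\<bar>x\<bar> * w / 2)) * x\<^sup>2"
    using n by (intro mult_mono) auto
  also have "\<dots> = x\<^sup>2 * exp (- (\<bar>x\<bar> * w / 2))" by (rule mult.commute)
  finally show ?thesis by (simp add: add_increasing)
qed

lemma normal_density_scale_measurable [measurable]:
  "(\<lambda>t. normal_density 0 (sqrt (1 + t * \<tau>\<^sup>2)) x) \<in> borel_measurable borel"
  unfolding normal_density_def by measurable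

text \<open>Transfers a bound on the squared shrinkage for each fixed variance to the mixture. The summand \<open>1\<close> in
  the constant is the bound on the conditional posterior variance \<open>\<kappa>\<close>.\<close>

lemma sq_error_about_observation:
  assumes dens: "is_prob_density f" and nonpos: "\<forall>t\<le>0. f t = 0" and \<tau>: "0 < \<tau>"
    and r: "0 \<le> r" "0 \<le> e"
    and bound: "\<And>u. 1 \<le> u \<Longrightarrow> normal_density 0 (sqrt u) x * (x / u)\<^sup>2
       \<le> r * normal_density 0 (sqrt u) x + e"
  shows "sq_error_integral (scaled_normal_mixture f \<tau>) x x
       \<le> ennreal (1 + r) * evidence (scaled_normal_mixture f \<tau>) x + ennreal e"
proof -
  have f[measurable]: "f \<in> borel_measurable borel" using dens by (simp add: is_prob_density_def)
  let ?n = "\<lambda>t. normal_density 0 (sqrt (1 + t * \<tau>\<^sup>2)) x"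
  have "sq_error_integral (scaled_normal_mixture f \<tau>) x x
      \<le> (\<integral>\<^sup>+t. ennreal (f t) * (ennreal (1 + r) * ennreal (?n t) + ennreal e) \<partial>lborel)"
    unfolding sq_error_integral_scaled_normal_mixture[OF f nonpos \<tau>]
  proof (intro nn_integral_mono)
    fix t
    show "ennreal (f t) * ennreal (?n t * (t * \<tau>\<^sup>2 / (1 + t * \<tau>\<^sup>2) + (t * \<tau>\<^sup>2 / (1 + t * \<tau>\<^sup>2) * x - x)\<^sup>2))
       \<le> ennreal (f t) * (ennreal (1 + r) * ennreal (?n t) + ennreal e)"
    proof (cases "t \<le> 0")
      case False
      define u where "u = 1 + t * \<tau>\<^sup>2"
      have u: "1 \<le> u" using False by (simp add: u_def)
      have "t * \<tau>\<^sup>2 / u * x - x = - (x / u)" "t * \<tau>\<^sup>2 / u \<le> 1"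
        using u by (auto simp: u_def field_simps)
      then have "?n t * (t * \<tau>\<^sup>2 / u + (t * \<tau>\<^sup>2 / u * x - x)\<^sup>2) \<le> ?n t * (1 + (x / u)\<^sup>2)"
        by (intro mult_left_mono) auto
      also have "\<dots> \<le> (1 + r) * ?n t + e"
        using bound[OF u] by (simp add: u_def algebra_simps)
      finally have "ennreal (?n t * (t * \<tau>\<^sup>2 / u + (t * \<tau>\<^sup>2 / u * x - x)\<^sup>2)) \<le> ennreal ((1 + r) * ?n t + e)"
        by (rule ennreal_leI)
      also have "\<dots> = ennreal (1 + r) * ennreal (?n t) + ennreal e"
        using r by (simp add: ennreal_mult' del: ennreal_plus add: ennreal_plus[of "(1 + r) * ?n t" e])
      finally show ?thesis by (auto simp: u_def intro!: mult_left_mono)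
    qed (simp add: nonpos)
  qed
  also have "\<dots> = (\<integral>\<^sup>+t. ennreal (1 + r) * (ennreal (f t) * ennreal (?n t)) + ennreal e * ennreal (f t) \<partial>lborel)"
    by (simp add: distrib_left ac_simps)
  also have "\<dots> = ennreal (1 + r) * (\<integral>\<^sup>+t. ennreal (f t) * ennreal (?n t) \<partial>lborel)
      + ennreal e * (\<integral>\<^sup>+t. ennreal (f t) \<partial>lborel)"
    by (simp add: nn_integral_add nn_integral_cmult)
  also have "\<dots> = ennreal (1 + r) * evidence (scaled_normal_mixture f \<tau>) x + ennreal e"
    using dens by (simp add: evidence_scaled_normal_mixture[OF f nonpos \<tau>] is_prob_density_def)
  finally show ?thesis .
qed

text \<open>The constant is uniform in the observation, which is what makes large signals harmless. The hypothesis
  on \<open>\<tau> powr (2 * a)\<close> is how the power relation between \<open>\<tau>\<close> and the sparsity enters: it allows the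
  lower bound on the evidence to be beaten by exponential decay.\<close>

lemma posterior_spread_about_observation:
  fixes K a c0 t0 A :: real and L :: "real \<Rightarrow> real"
  assumes dens: "is_prob_density (power_mixing_density K a L)"
    and pos: "0 < K" "0 < a" "0 < c0" "0 < t0"
    and L_lower: "\<forall>t\<ge>t0. c0 < L t" and A: "0 \<le> A"
  obtains C where "0 < C"
    "\<And>\<tau> l x. \<lbrakk>0 < \<tau>; \<tau> \<le> 1; 1 \<le> l; t0 \<le> l; exp (- (A * l)) \<le> \<tau> powr (2 * a)\<rbrakk> \<Longrightarrow>
      sq_error_integral (scaled_normal_mixture (power_mixing_density K a L) \<tau>) x x
       \<le> ennreal (C * l) * evidence (scaled_normal_mixture (power_mixing_density K a L) \<tau>) x"
proof -
  define c where "c = K * c0 * 2 powr (- (a + 1)) * (exp (- (1 / 2)) / sqrt (6 * pi))"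
  \<comment> \<open>The power \<open>2 * a + 1\<close> lost in the evidence, plus 2 for the factor \<open>x\<^sup>2\<close>.\<close>
  define b where "b = 2 * a + 3"
  \<comment> \<open>Makes \<open>\<bar>x\<bar> * sqrt l / 4\<close> exceed \<open>A * l\<close> as soon as \<open>\<bar>x\<bar> \<ge> B * sqrt l\<close>.\<close>
  define B where "B = 4 * A + 1"
  define C2 where "C2 = (4 * b) powr b / c"
  have c: "0 < c" using pos by (simp add: c_def)
  have b: "0 < b" using pos by (simp add: b_def)
  have B: "1 \<le> B" using A by (simp add: B_def)
  have C2: "0 \<le> C2" using c by (simp add: C2_def)
  show thesis
  proof (rule that[of "2 + B\<^sup>2 + C2"])
    show "0 < 2 + B\<^sup>2 + C2" using C2 by (simp add: add_pos_nonneg)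
    fix \<tau> l x :: real
    assume \<tau>: "0 < \<tau>" "\<tau> \<le> 1" and l: "1 \<le> l" "t0 \<le> l" and \<tau>A: "exp (- (A * l)) \<le> \<tau> powr (2 * a)"
    let ?G = "scaled_normal_mixture (power_mixing_density K a L) \<tau>"
    show "sq_error_integral ?G x x \<le> ennreal ((2 + B\<^sup>2 + C2) * l) * evidence ?G x"
    proof (cases "x\<^sup>2 \<le> B\<^sup>2 * l")
      case True
      have "sq_error_integral ?G x x \<le> ennreal (1 + B\<^sup>2 * l) * evidence ?G x + ennreal 0"
      proof (rule sq_error_about_observation[OF dens _ \<tau>(1)])
        fix u :: real assume "1 \<le> u"
        then have "(x / u)\<^sup>2 \<le> x\<^sup>2"
          by (simp add: power_divide divide_le_eq mult_le_cancel_left1)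
        then have "(x / u)\<^sup>2 \<le> B\<^sup>2 * l" using True by simp
        then have "normal_density 0 (sqrt u) x * (x / u)\<^sup>2 \<le> normal_density 0 (sqrt u) x * (B\<^sup>2 * l)"
          by (intro mult_left_mono) auto
        then show "normal_density 0 (sqrt u) x * (x / u)\<^sup>2 \<le> B\<^sup>2 * l * normal_density 0 (sqrt u) x + 0"
          by (simp add: mult.commute)
      qed (use l in \<open>auto simp: power_mixing_density_nonpos\<close>)
      also have "\<dots> \<le> ennreal ((2 + B\<^sup>2 + C2) * l) * evidence ?G x"
      proof -
        have "0 \<le> C2 * l" using C2 l by simp
        then have "1 + B\<^sup>2 * l \<le> (2 + B\<^sup>2 + C2) * l" using l by (simp add: algebra_simps)
        then show ?thesis by (auto intro!: mult_right_mono ennreal_leI)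
      qed
      finally show ?thesis .
    next
      case False
      define y where "y = \<bar>x\<bar>"
      have lB: "l \<le> B\<^sup>2 * l" using B l by (simp add: mult_le_cancel_right1)
      have x2: "1 \<le> x\<^sup>2" "t0 \<le> x\<^sup>2" using False l lB by linarith+
      have y: "0 < y" using x2 by (auto simp: y_def)
      have w: "1 \<le> sqrt l" "(sqrt l)\<^sup>2 = l" using l by auto
      have "(B * sqrt l)\<^sup>2 \<le> y\<^sup>2" using False w by (simp add: y_def power_mult_distrib)
      then have yB: "B * sqrt l \<le> y" by (rule power2_le_imp_le) (use y in simp)
      have Bl: "B * sqrt l * sqrt l \<le> y * sqrt l" using yB w by (intro mult_right_mono) auto
      have 1: "4 * (A * l) \<le> y * sqrt l"
      proof -
        have "B * sqrt l * sqrt l = 4 * (A * l) + l"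
          using l by (simp add: B_def algebra_simps)
        with Bl show ?thesis using l by linarith
      qed
      have 2: "y \<le> y * sqrt l" using y w by (simp add: mult_le_cancel_left1)
      have "y powr b * exp (- (y * sqrt l / 2)) \<le> (4 * b) powr b * exp (y / 4) * exp (- (y * sqrt l / 2))"
        using powr_le_exp_quarter[OF y b] by (intro mult_right_mono) auto
      also have "\<dots> = (4 * b) powr b * exp (y / 4 - y * sqrt l / 2)"
        by (simp only: mult.assoc exp_add[symmetric] diff_conv_add_uminus)
      also have "\<dots> \<le> (4 * b) powr b * exp (- (A * l))"
        using 1 2 by (intro mult_left_mono) auto
      also have "\<dots> \<le> (4 * b) powr b * \<tau> powr (2 * a)"
        using \<tau>A by (intro mult_left_mono) auto
      also have "\<dots> = C2 * c * \<tau> powr (2 * a)" using c by (simp add: C2_def)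
      finally have ineq: "y powr b * exp (- (y * sqrt l / 2)) * y powr (- (2 * a + 1))
          \<le> C2 * c * \<tau> powr (2 * a) * y powr (- (2 * a + 1))"
        by (intro mult_right_mono) auto
      have pw: "y powr b * y powr (- (2 * a + 1)) = x\<^sup>2"
      proof -
        have "y powr b * y powr (- (2 * a + 1)) = y powr (b + - (2 * a + 1))" by (rule powr_add[symmetric])
        also have "b + - (2 * a + 1) = 2" by (simp add: b_def)
        finally show ?thesis using y by (simp add: y_def)
      qed
      have "x\<^sup>2 * exp (- (y * sqrt l / 2)) = y powr b * exp (- (y * sqrt l / 2)) * y powr (- (2 * a + 1))"
        unfolding pw[symmetric] by (simp only: ac_simps)
      also note ineq
      also have "C2 * c * \<tau> powr (2 * a) * y powr (- (2 * a + 1)) = C2 * (c * \<tau> powr (2 * a) * y powr (- (2 * a + 1)))"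
        by simp
      finally have e: "x\<^sup>2 * exp (- (y * sqrt l / 2)) \<le> C2 * (c * \<tau> powr (2 * a) * y powr (- (2 * a + 1)))" .
      have "sq_error_integral ?G x x
          \<le> ennreal (1 + l) * evidence ?G x + ennreal (x\<^sup>2 * exp (- (\<bar>x\<bar> * sqrt l / 2)))"
      proof (rule sq_error_about_observation[OF dens _ \<tau>(1)])
        fix u :: real assume "1 \<le> u"
        then show "normal_density 0 (sqrt u) x * (x / u)\<^sup>2
            \<le> l * normal_density 0 (sqrt u) x + x\<^sup>2 * exp (- (\<bar>x\<bar> * sqrt l / 2))"
          using shrinkage_tradeoff[of u "sqrt l" x] w by simp
      qed (use l in \<open>auto simp: power_mixing_density_nonpos\<close>)
      also have "ennreal (x\<^sup>2 * exp (- (\<bar>x\<bar> * sqrt l / 2))) \<le> ennreal C2 * evidence ?G x"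
      proof -
        have "ennreal (x\<^sup>2 * exp (- (\<bar>x\<bar> * sqrt l / 2)))
            \<le> ennreal C2 * ennreal (c * \<tau> powr (2 * a) * y powr (- (2 * a + 1)))"
          using e C2 by (simp add: ennreal_mult'[symmetric] y_def ennreal_leI)
        also have "\<dots> \<le> ennreal C2 * evidence ?G x"
          using evidence_tail_lower[OF dens pos \<tau> L_lower x2]
          by (intro mult_left_mono) (auto simp: c_def y_def)
        finally show ?thesis .
      qed
      also have "ennreal (1 + l) * evidence ?G x + ennreal C2 * evidence ?G x
          = ennreal (1 + l + C2) * evidence ?G x"
        using l C2 by (simp add: distrib_right ennreal_plus)
      also have "\<dots> \<le> ennreal ((2 + B\<^sup>2 + C2) * l) * evidence ?G x"
      proof -
        have "C2 \<le> C2 * l" "0 \<le> B\<^sup>2 * l" using C2 l by (auto simp: mult_le_cancel_left1)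
        then have "1 + l + C2 \<le> (2 + B\<^sup>2 + C2) * l" using l unfolding distrib_right by linarith
        then show ?thesis by (auto intro!: mult_right_mono ennreal_leI)
      qed
      finally show ?thesis by (simp add: add_left_mono)
    qed
  qed
qed

text \<open>For \<open>\<tau> \<le> 1\<close> the density with variance \<open>1 + t * \<tau>\<^sup>2\<close> is at least \<open>1 / sqrt (1 + t)\<close> times the
  standard one, so \<open>c\<close> can be the integral of \<open>1 / sqrt (1 + t)\<close> against the mixing density; it does
  not depend on \<open>\<tau>\<close>.\<close>

lemma evidence_ge_standard_normal:
  assumes dens: "is_prob_density f" and nonpos: "\<forall>t\<le>0. f t = 0"
  obtains c where "0 < c"
    "\<And>\<tau> x. 0 < \<tau> \<Longrightarrow> \<tau> \<le> 1 \<Longrightarrow>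
      ennreal (c * normal_density 0 1 x) \<le> evidence (scaled_normal_mixture f \<tau>) x"
proof -
  have f[measurable]: "f \<in> borel_measurable borel" and f0: "\<And>t. 0 \<le> f t"
    using dens by (auto simp: is_prob_density_def)
  let ?g = "\<lambda>t. ennreal (f t) * ennreal (1 / sqrt (1 + t))"
  define I where "I = (\<integral>\<^sup>+t. ?g t \<partial>lborel)"
  have "I \<le> (\<integral>\<^sup>+t. ennreal (f t) \<partial>lborel)"
    unfolding I_def
  proof (intro nn_integral_mono)
    fix t
    show "?g t \<le> ennreal (f t)"
      using f0[of t] by (cases "t \<le> 0")
        (auto simp: nonpos ennreal_mult'[symmetric] divide_le_eq mult_le_cancel_left1 intro!: ennreal_leI)
  qed
  then have fin: "I < \<top>" using dens by (auto simp: is_prob_density_def less_top[symmetric] top_unique)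
  have "I \<noteq> 0"
  proof
    assume "I = 0"
    then have "AE t in lborel. ?g t = 0"
      unfolding I_def by (subst (asm) nn_integral_0_iff_AE) auto
    then have "AE t in lborel. ennreal (f t) = 0"
    proof eventually_elim
      case (elim t)
      then show ?case by (cases "t \<le> 0") (auto simp: nonpos ennreal_eq_0_iff)
    qed
    then have "(\<integral>\<^sup>+t. ennreal (f t) \<partial>lborel) = 0"
      by (subst nn_integral_0_iff_AE) auto
    then show False using dens by (simp add: is_prob_density_def)
  qed
  then obtain c where c: "I = ennreal c" "0 < c"
    using fin by (cases I) (auto simp: less_le)
  show thesis
  proof (rule that[OF c(2)])
    fix \<tau> x :: real assume \<tau>: "0 < \<tau>" "\<tau> \<le> 1"
    have "ennreal (c * normal_density 0 1 x) = (\<integral>\<^sup>+t. ?g t * ennreal (normal_density 0 1 x) \<partial>lborel)"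
      using c by (subst nn_integral_multc) (auto simp: I_def[symmetric] ennreal_mult')
    also have "\<dots> \<le> (\<integral>\<^sup>+t. ennreal (f t) * ennreal (normal_density 0 (sqrt (1 + t * \<tau>\<^sup>2)) x) \<partial>lborel)"
    proof (intro nn_integral_mono)
      fix t
      show "?g t * ennreal (normal_density 0 1 x)
          \<le> ennreal (f t) * ennreal (normal_density 0 (sqrt (1 + t * \<tau>\<^sup>2)) x)"
      proof (cases "t \<le> 0")
        case False
        let ?u = "1 + t * \<tau>\<^sup>2"
        have u: "1 \<le> ?u" "?u \<le> 1 + t"
          using False \<tau> by (auto simp: mult_left_le power_le_one)
        have u': "0 < ?u" using u by linarith
        have "sqrt ?u \<le> sqrt (1 + t)" using u by simp
        then have "1 / sqrt (1 + t) * (1 / sqrt (2 * pi)) \<le> 1 / sqrt ?u * (1 / sqrt (2 * pi))"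
          using u' False by (intro mult_right_mono divide_left_mono) (auto simp: add_pos_nonneg)
        also have "\<dots> = 1 / sqrt (2 * pi * ?u)" by (simp only: real_sqrt_mult) simp
        finally have 1: "1 / sqrt (1 + t) * (1 / sqrt (2 * pi)) \<le> 1 / sqrt (2 * pi * ?u)" .
        have "x\<^sup>2 / (2 * ?u) \<le> x\<^sup>2 / 2"
          using u by (intro divide_left_mono) auto
        then have 2: "exp (- x\<^sup>2 / 2) \<le> exp (- x\<^sup>2 / (2 * ?u))" by simp
        have "1 / sqrt (1 + t) * (1 / sqrt (2 * pi)) * exp (- x\<^sup>2 / 2)
            \<le> 1 / sqrt (2 * pi * ?u) * exp (- x\<^sup>2 / (2 * ?u))"
          using 1 2 u' by (intro mult_mono) (auto intro: add_nonneg_nonneg)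
        then have "1 / sqrt (1 + t) * normal_density 0 1 x \<le> normal_density 0 (sqrt ?u) x"
          using u' by (simp add: normal_density_def)
        then have "f t * (1 / sqrt (1 + t) * normal_density 0 1 x) \<le> f t * normal_density 0 (sqrt ?u) x"
          using f0 by (intro mult_left_mono)
        then show ?thesis
          using f0[of t] False by (simp add: ennreal_mult'[symmetric] ennreal_leI mult.assoc)
      qed (simp add: nonpos)
    qed
    also have "\<dots> = evidence (scaled_normal_mixture f \<tau>) x"
      by (intro evidence_scaled_normal_mixture[symmetric] f nonpos \<tau>)
    finally show "ennreal (c * normal_density 0 1 x) \<le> evidence (scaled_normal_mixture f \<tau>) x" .
  qed
qed

section \<open>The risk of one coordinate\<close>

text \<open>The triangle inequality through the observation: the posterior is close to \<open>x\<close>, and \<open>x\<close> is close to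
  the mean \<open>m\<close>.\<close>

lemma coordinate_loss_le:
  assumes G: "prob_space G" "sets G = sets borel" and r: "0 \<le> r"
    and spread: "sq_error_integral G x x \<le> ennreal r * evidence G x"
  shows "coordinate_loss G m x \<le> ennreal (2 * r + 2 * (x - m)\<^sup>2)"
proof -
  note [measurable_cong] = G(2)
  have "sq_error_integral G m x
      \<le> (\<integral>\<^sup>+\<theta>. ennreal 2 * ennreal ((\<theta> - x)\<^sup>2 * normal_density \<theta> 1 x)
          + ennreal (2 * (x - m)\<^sup>2) * ennreal (normal_density \<theta> 1 x) \<partial>G)"
    unfolding sq_error_integral_def
  proof (intro nn_integral_mono)
    fix \<theta>
    have "(\<theta> - m)\<^sup>2 \<le> 2 * (\<theta> - x)\<^sup>2 + 2 * (x - m)\<^sup>2"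
      using zero_le_power2[of "(\<theta> - x) - (x - m)"] by (simp add: power2_eq_square algebra_simps)
    then have "(\<theta> - m)\<^sup>2 * normal_density \<theta> 1 x
        \<le> (2 * (\<theta> - x)\<^sup>2 + 2 * (x - m)\<^sup>2) * normal_density \<theta> 1 x"
      by (intro mult_right_mono) auto
    then have "ennreal ((\<theta> - m)\<^sup>2 * normal_density \<theta> 1 x)
        \<le> ennreal (2 * ((\<theta> - x)\<^sup>2 * normal_density \<theta> 1 x) + 2 * (x - m)\<^sup>2 * normal_density \<theta> 1 x)"
      by (intro ennreal_leI) (simp add: algebra_simps)
    then show "ennreal ((\<theta> - m)\<^sup>2 * normal_density \<theta> 1 x)
        \<le> ennreal 2 * ennreal ((\<theta> - x)\<^sup>2 * normal_density \<theta> 1 x)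
          + ennreal (2 * (x - m)\<^sup>2) * ennreal (normal_density \<theta> 1 x)"
      by (subst (asm) ennreal_plus) (auto simp only: ennreal_mult zero_le_power2 normal_density_nonneg
          mult_nonneg_nonneg zero_le_numeral)
  qed
  also have "\<dots> = ennreal 2 * sq_error_integral G x x + ennreal (2 * (x - m)\<^sup>2) * evidence G x"
    unfolding sq_error_integral_def evidence_def
    by (subst nn_integral_add) (auto simp: nn_integral_cmult)
  also have "\<dots> \<le> ennreal 2 * (ennreal r * evidence G x) + ennreal (2 * (x - m)\<^sup>2) * evidence G x"
    by (intro add_right_mono mult_left_mono spread) auto
  also have "\<dots> = ennreal (2 * r + 2 * (x - m)\<^sup>2) * evidence G x"
    using r by (simp add: ennreal_plus ennreal_mult distrib_right mult.assoc)
  finally show ?thesis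
    unfolding coordinate_loss_def using evidence_pos[OF G] by (intro divide_le_posI_ennreal) (auto simp: mult.commute)
qed

lemma normal_density_total:
  "0 < \<sigma> \<Longrightarrow> (\<integral>\<^sup>+x. ennreal (normal_density \<mu> \<sigma> x) \<partial>lborel) = 1"
  using prob_space.emeasure_space_1[OF prob_space_normal_density[of \<sigma> \<mu>]]
  by (simp add: emeasure_density)

lemma normal_density_quadratic:
  assumes "0 < \<sigma>" "0 \<le> b" "0 \<le> c"
  shows "(\<integral>\<^sup>+x. ennreal (normal_density \<mu> \<sigma> x * (b + c * (x - m)\<^sup>2)) \<partial>lborel)
       = ennreal (b + c * (\<sigma>\<^sup>2 + (\<mu> - m)\<^sup>2))"
proof -
  have "(\<integral>\<^sup>+x. ennreal (normal_density \<mu> \<sigma> x * (b + c * (x - m)\<^sup>2)) \<partial>lborel)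
      = (\<integral>\<^sup>+x. ennreal b * ennreal (normal_density \<mu> \<sigma> x)
          + ennreal c * ennreal ((x - m)\<^sup>2 * normal_density \<mu> \<sigma> x) \<partial>lborel)"
  proof (intro nn_integral_cong)
    fix x
    have "normal_density \<mu> \<sigma> x * (b + c * (x - m)\<^sup>2)
        = b * normal_density \<mu> \<sigma> x + c * ((x - m)\<^sup>2 * normal_density \<mu> \<sigma> x)"
      by algebra
    then show "ennreal (normal_density \<mu> \<sigma> x * (b + c * (x - m)\<^sup>2))
        = ennreal b * ennreal (normal_density \<mu> \<sigma> x)
          + ennreal c * ennreal ((x - m)\<^sup>2 * normal_density \<mu> \<sigma> x)"
      using assms by (simp only: ennreal_plus ennreal_mult zero_le_power2 normal_density_nonneg
          mult_nonneg_nonneg)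
  qed
  also have "\<dots> = ennreal b + ennreal c * ennreal (\<sigma>\<^sup>2 + (\<mu> - m)\<^sup>2)"
    using assms by (subst nn_integral_add)
      (auto simp del: ennreal_plus simp: nn_integral_cmult normal_density_total normal_second_moment)
  also have "\<dots> = ennreal (b + c * (\<sigma>\<^sup>2 + (\<mu> - m)\<^sup>2))"
    using assms by (simp only: ennreal_plus ennreal_mult zero_le_power2 add_nonneg_nonneg mult_nonneg_nonneg)
  finally show ?thesis .
qed

lemma coordinate_risk_eq:
  assumes G: "prob_space G" "sets G = sets borel"
  shows "coordinate_risk G m
       = (\<integral>\<^sup>+x. ennreal (normal_density m 1 x) * coordinate_loss G m x \<partial>lborel)"
  unfolding coordinate_risk_def
  by (subst nn_integral_normal_law) (auto intro: coordinate_loss_measurable[OF G])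

lemma coordinate_risk_le:
  assumes G: "prob_space G" "sets G = sets borel" and r: "0 \<le> r"
    and spread: "\<And>x. sq_error_integral G x x \<le> ennreal r * evidence G x"
  shows "coordinate_risk G m \<le> ennreal (2 * r + 2)"
proof -
  have "coordinate_risk G m \<le> (\<integral>\<^sup>+x. ennreal (normal_density m 1 x) * ennreal (2 * r + 2 * (x - m)\<^sup>2) \<partial>lborel)"
    unfolding coordinate_risk_eq[OF G]
    by (intro nn_integral_mono mult_left_mono coordinate_loss_le[OF G r spread]) auto
  also have "\<dots> = (\<integral>\<^sup>+x. ennreal (normal_density m 1 x * (2 * r + 2 * (x - m)\<^sup>2)) \<partial>lborel)"
    using r by (simp only: ennreal_mult normal_density_nonneg add_nonneg_nonneg zero_le_power2
        mult_nonneg_nonneg zero_le_numeral)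
  also have "\<dots> = ennreal (2 * r + 2)"
    using r by (subst normal_density_quadratic) auto
  finally show ?thesis .
qed

text \<open>Half of the Gaussian exponent pays for the tail probability; what remains is a normal density with
  variance 2, against which the quadratic is integrated over the whole line.\<close>

lemma normal_tail_quadratic:
  fixes r \<zeta> :: real
  assumes r: "0 \<le> r" and \<zeta>: "0 \<le> \<zeta>"
  shows "(\<integral>\<^sup>+x. ennreal (normal_density 0 1 x * (2 * r + 2 * x\<^sup>2)) * indicator {x. \<zeta> < \<bar>x\<bar>} x \<partial>lborel)
       \<le> ennreal (sqrt 2 * exp (- \<zeta>\<^sup>2 / 4) * (2 * r + 4))"
proof -
  let ?k = "sqrt 2 * exp (- \<zeta>\<^sup>2 / 4)"
  have "(\<integral>\<^sup>+x. ennreal (normal_density 0 1 x * (2 * r + 2 * x\<^sup>2)) * indicator {x. \<zeta> < \<bar>x\<bar>} x \<partial>lborel)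
      \<le> (\<integral>\<^sup>+x. ennreal ?k * ennreal (normal_density 0 (sqrt 2) x * (2 * r + 2 * (x - 0)\<^sup>2)) \<partial>lborel)"
  proof (intro nn_integral_mono)
    fix x :: real
    have "sqrt (2 * pi * 2) = sqrt 2 * sqrt (2 * pi)" by (simp add: real_sqrt_mult)
    then have \<phi>: "normal_density 0 1 x = sqrt 2 * exp (- x\<^sup>2 / 4) * normal_density 0 (sqrt 2) x"
      by (simp add: normal_density_def mult_exp_exp)
    show "ennreal (normal_density 0 1 x * (2 * r + 2 * x\<^sup>2)) * indicator {x. \<zeta> < \<bar>x\<bar>} x
        \<le> ennreal ?k * ennreal (normal_density 0 (sqrt 2) x * (2 * r + 2 * (x - 0)\<^sup>2))"
    proof (cases "\<zeta> < \<bar>x\<bar>")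
      case True
      then have "\<zeta>\<^sup>2 \<le> \<bar>x\<bar>\<^sup>2" using \<zeta> by (intro power_mono) auto
      then have "sqrt 2 * exp (- x\<^sup>2 / 4) \<le> ?k" by simp
      then have "sqrt 2 * exp (- x\<^sup>2 / 4) * (normal_density 0 (sqrt 2) x * (2 * r + 2 * x\<^sup>2))
          \<le> ?k * (normal_density 0 (sqrt 2) x * (2 * r + 2 * x\<^sup>2))"
        using r by (intro mult_right_mono) auto
      then show ?thesis
        using True r by (simp add: \<phi> ennreal_mult'[symmetric] mult.assoc ennreal_leI)
    qed simp
  qed
  also have "\<dots> = ennreal ?k * ennreal (2 * r + 2 * ((sqrt 2)\<^sup>2 + (0 - 0)\<^sup>2))"
    using r by (subst nn_integral_cmult, measurable) (subst normal_density_quadratic, auto)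
  also have "\<dots> = ennreal (?k * (2 * r + 4))"
    by (simp add: ennreal_mult'[symmetric])
  finally show ?thesis .
qed

text \<open>The second moment of a centred normal coordinate with variance \<open>v\<close>, restricted to observations
  \<open>\<bar>x\<bar> \<le> \<zeta>\<close>, after the coordinate has been integrated out.\<close>

definition truncated_moment :: "real \<Rightarrow> real \<Rightarrow> ennreal" where
  "truncated_moment \<zeta> v = (\<integral>\<^sup>+x. ennreal (normal_density 0 (sqrt (1 + v)) x *
      (v / (1 + v) + (v / (1 + v) * x)\<^sup>2)) * indicator {x. \<bar>x\<bar> \<le> \<zeta>} x \<partial>lborel)"

text \<open>Without the truncation this is the prior second moment, computed by conditioning on the observation,
  and hence equal to \<open>v\<close>.\<close>

lemma truncated_moment_le_variance:
  assumes v: "0 < v"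
  shows "truncated_moment \<zeta> v \<le> ennreal v"
proof -
  let ?\<kappa> = "v / (1 + v)"
  have "truncated_moment \<zeta> v
      \<le> (\<integral>\<^sup>+x. ennreal (normal_density 0 (sqrt (1 + v)) x * (?\<kappa> + ?\<kappa>\<^sup>2 * (x - 0)\<^sup>2)) \<partial>lborel)"
    unfolding truncated_moment_def
    by (intro nn_integral_mono) (auto simp: indicator_def power_mult_distrib power_divide)
  also have "\<dots> = ennreal (?\<kappa> + ?\<kappa>\<^sup>2 * ((sqrt (1 + v))\<^sup>2 + (0 - 0)\<^sup>2))"
    using v by (intro normal_density_quadratic) auto
  also have "?\<kappa> + ?\<kappa>\<^sup>2 * ((sqrt (1 + v))\<^sup>2 + (0 - 0)\<^sup>2) = v"
  proof -
    have "?\<kappa> * (1 + v) = v" using v by simp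
    moreover have "?\<kappa> + ?\<kappa>\<^sup>2 * ((sqrt (1 + v))\<^sup>2 + (0 - 0)\<^sup>2) = ?\<kappa> + ?\<kappa> * (?\<kappa> * (1 + v))"
      using v by (simp add: power2_eq_square)
    ultimately show ?thesis using v by (simp add: distrib_left)
  qed
  finally show ?thesis .
qed

text \<open>Large prior variances put little mass on observations in the window: the density is at most of order
  \<open>1 / sqrt v\<close>, the window has length \<open>2 * \<zeta>\<close>, and the integrand there is at most \<open>1 + \<zeta>\<^sup>2\<close>.\<close>

lemma truncated_moment_le_window:
  assumes v: "0 < v" and \<zeta>: "1 \<le> \<zeta>"
  shows "truncated_moment \<zeta> v \<le> ennreal (2 * \<zeta> ^ 3 / sqrt v)"
proof -
  let ?\<kappa> = "v / (1 + v)"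
  let ?b = "1 / (2 * sqrt v) * (1 + \<zeta>\<^sup>2)"
  have "truncated_moment \<zeta> v \<le> (\<integral>\<^sup>+x. ennreal ?b * indicator {- \<zeta>..\<zeta>} x \<partial>lborel)"
    unfolding truncated_moment_def
  proof (intro nn_integral_mono)
    fix x :: real
    show "ennreal (normal_density 0 (sqrt (1 + v)) x * (?\<kappa> + (?\<kappa> * x)\<^sup>2)) * indicator {x. \<bar>x\<bar> \<le> \<zeta>} x
        \<le> ennreal ?b * indicator {- \<zeta>..\<zeta>} x"
    proof (cases "\<bar>x\<bar> \<le> \<zeta>")
      case True
      have "sqrt (2\<^sup>2 * v) \<le> sqrt (2 * pi * (1 + v))"
        using v pi_gt3 by (intro real_sqrt_le_mono mult_mono) auto
      then have "2 * sqrt v \<le> sqrt (2 * pi * (1 + v))" by (simp add: real_sqrt_mult)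
      then have "1 / sqrt (2 * pi * (1 + v)) \<le> 1 / (2 * sqrt v)"
        using v by (intro divide_left_mono) auto
      then have "1 / sqrt (2 * pi * (1 + v)) * exp (- x\<^sup>2 / (2 * (1 + v))) \<le> 1 / (2 * sqrt v) * 1"
        using v by (intro mult_mono) auto
      then have n: "normal_density 0 (sqrt (1 + v)) x \<le> 1 / (2 * sqrt v)"
        using v by (simp add: normal_density_def)
      have \<kappa>: "0 \<le> ?\<kappa>" "?\<kappa> \<le> 1" using v by auto
      have "\<bar>?\<kappa> * x\<bar> \<le> 1 * \<zeta>"
        unfolding abs_mult abs_of_nonneg[OF \<kappa>(1)] using \<kappa> True by (intro mult_mono) auto
      then have "\<bar>?\<kappa> * x\<bar>\<^sup>2 \<le> (1 * \<zeta>)\<^sup>2"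
        by (rule power_mono) (rule abs_ge_zero)
      then have "(?\<kappa> * x)\<^sup>2 \<le> \<zeta>\<^sup>2"
        by (simp only: power2_abs mult_1)
      then have "?\<kappa> + (?\<kappa> * x)\<^sup>2 \<le> 1 + \<zeta>\<^sup>2"
        using \<kappa> by linarith
      then have "normal_density 0 (sqrt (1 + v)) x * (?\<kappa> + (?\<kappa> * x)\<^sup>2) \<le> ?b"
        using n \<kappa> v by (intro mult_mono) auto
      then show ?thesis using True by (auto simp: indicator_def intro!: ennreal_leI)
    qed simp
  qed
  also have "\<dots> = ennreal ?b * ennreal (2 * \<zeta>)"
    using \<zeta> by (simp add: nn_integral_cmult_indicator)
  also have "\<dots> = ennreal ((1 + \<zeta>\<^sup>2) * \<zeta> / sqrt v)"
    using v \<zeta> by (simp add: ennreal_mult'[symmetric] mult.commute)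
  also have "\<dots> \<le> ennreal (2 * \<zeta> ^ 3 / sqrt v)"
  proof -
    have "1 + \<zeta>\<^sup>2 \<le> 2 * \<zeta>\<^sup>2" using \<zeta> by simp
    then have "(1 + \<zeta>\<^sup>2) * \<zeta> \<le> 2 * \<zeta>\<^sup>2 * \<zeta>" using \<zeta> by (intro mult_right_mono) auto
    also have "\<dots> = 2 * \<zeta> ^ 3" by (simp add: power2_eq_square power3_eq_cube)
    finally show ?thesis using v by (intro ennreal_leI divide_right_mono) auto
  qed
  finally show ?thesis .
qed

lemma truncated_sq_error_integral:
  assumes f: "f \<in> borel_measurable borel" "\<forall>t\<le>0. f t = 0" and \<tau>: "0 < \<tau>"
  shows "(\<integral>\<^sup>+x. sq_error_integral (scaled_normal_mixture f \<tau>) 0 x * indicator {x. \<bar>x\<bar> \<le> \<zeta>} x \<partial>lborel)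
       = (\<integral>\<^sup>+t. ennreal (f t) * truncated_moment \<zeta> (t * \<tau>\<^sup>2) \<partial>lborel)"
proof -
  note [measurable] = f(1)
  let ?h = "\<lambda>t x. ennreal (normal_density 0 (sqrt (1 + t * \<tau>\<^sup>2)) x *
            (t * \<tau>\<^sup>2 / (1 + t * \<tau>\<^sup>2) + (t * \<tau>\<^sup>2 / (1 + t * \<tau>\<^sup>2) * x)\<^sup>2))"
  have meas: "(\<lambda>(x, t). ennreal (f t) * ?h t x * indicator {x. \<bar>x\<bar> \<le> \<zeta>} x) \<in> borel_measurable (lborel \<Otimes>\<^sub>M lborel)"
    unfolding normal_density_def by measurable
  have [measurable]: "?h t \<in> borel_measurable borel" "(\<lambda>t. ?h t x) \<in> borel_measurable borel" for t x
    unfolding normal_density_def by measurable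
  have "(\<integral>\<^sup>+x. sq_error_integral (scaled_normal_mixture f \<tau>) 0 x * indicator {x. \<bar>x\<bar> \<le> \<zeta>} x \<partial>lborel)
      = (\<integral>\<^sup>+x. \<integral>\<^sup>+t. ennreal (f t) * ?h t x * indicator {x. \<bar>x\<bar> \<le> \<zeta>} x \<partial>lborel \<partial>lborel)"
    by (intro nn_integral_cong)
      (simp add: sq_error_integral_scaled_normal_mixture[OF f \<tau>] nn_integral_multc)
  also have "\<dots> = (\<integral>\<^sup>+t. \<integral>\<^sup>+x. ennreal (f t) * ?h t x * indicator {x. \<bar>x\<bar> \<le> \<zeta>} x \<partial>lborel \<partial>lborel)"
    by (rule lborel_pair.Fubini'[OF meas, symmetric])
  also have "\<dots> = (\<integral>\<^sup>+t. ennreal (f t) * truncated_moment \<zeta> (t * \<tau>\<^sup>2) \<partial>lborel)"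
    by (intro nn_integral_cong) (simp add: truncated_moment_def mult.assoc nn_integral_cmult)
  finally show ?thesis .
qed

text \<open>Outside the window the spread about the observation is integrated against the Gaussian tail. Inside
  it, the lower bound on the evidence cancels the density of the observation, and Fubini's theorem
  applies to what is left.\<close>

lemma coordinate_risk_zero_le:
  fixes r c \<zeta> \<tau> :: real
  assumes dens: "is_prob_density f" and nonpos: "\<forall>t\<le>0. f t = 0" and \<tau>: "0 < \<tau>"
    and r: "0 \<le> r" and c: "0 < c" and \<zeta>: "1 \<le> \<zeta>"
    and spread: "\<And>x. sq_error_integral (scaled_normal_mixture f \<tau>) x x
      \<le> ennreal r * evidence (scaled_normal_mixture f \<tau>) x"
    and lower: "\<And>x. ennreal (c * normal_density 0 1 x) \<le> evidence (scaled_normal_mixture f \<tau>) x"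
  shows "coordinate_risk (scaled_normal_mixture f \<tau>) 0
       \<le> ennreal (sqrt 2 * exp (- \<zeta>\<^sup>2 / 4) * (2 * r + 4))
        + ennreal (1 / c) * (\<integral>\<^sup>+t. ennreal (f t) * ennreal (min (t * \<tau>\<^sup>2) (2 * \<zeta> ^ 3 / sqrt (t * \<tau>\<^sup>2))) \<partial>lborel)"
proof -
  have f: "f \<in> borel_measurable borel" using dens by (simp add: is_prob_density_def)
  define G where "G = scaled_normal_mixture f \<tau>"
  have G: "prob_space G" "sets G = sets borel"
    using prob_space_scaled_normal_mixture[OF dens] by (auto simp: G_def)
  note [measurable] = sq_error_integral_measurable[OF G]
  let ?far = "\<lambda>x. ennreal (normal_density 0 1 x * (2 * r + 2 * x\<^sup>2)) * indicator {x. \<zeta> < \<bar>x\<bar>} x"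
  let ?near = "\<lambda>x. sq_error_integral G 0 x * indicator {x. \<bar>x\<bar> \<le> \<zeta>} x"
  have "coordinate_risk G 0 \<le> (\<integral>\<^sup>+x. ?far x + ennreal (1 / c) * ?near x \<partial>lborel)"
    unfolding coordinate_risk_eq[OF G]
  proof (intro nn_integral_mono)
    fix x :: real
    let ?\<phi> = "normal_density 0 1 x"
    show "ennreal ?\<phi> * coordinate_loss G 0 x \<le> ?far x + ennreal (1 / c) * ?near x"
    proof (cases "\<bar>x\<bar> \<le> \<zeta>")
      case True
      have "ennreal ?\<phi> = ennreal (1 / c) * ennreal (c * ?\<phi>)"
        using c by (simp add: ennreal_mult'[symmetric])
      also have "\<dots> \<le> ennreal (1 / c) * evidence G x"
        using lower by (intro mult_left_mono) (auto simp: G_def)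
      finally have "ennreal ?\<phi> * coordinate_loss G 0 x
          \<le> ennreal (1 / c) * evidence G x * (sq_error_integral G 0 x / evidence G x)"
        unfolding coordinate_loss_def by (intro mult_right_mono) auto
      also have "\<dots> = ennreal (1 / c) * (sq_error_integral G 0 x * evidence G x / evidence G x)"
        by (simp add: ennreal_times_divide ac_simps)
      also have "\<dots> = ennreal (1 / c) * sq_error_integral G 0 x"
        using evidence_pos[OF G, of x] evidence_less_top[OF G, of x] by (subst mult_divide_eq_ennreal) auto
      finally show ?thesis using True by simp
    next
      case False
      have "ennreal ?\<phi> * coordinate_loss G 0 x \<le> ennreal ?\<phi> * ennreal (2 * r + 2 * (x - 0)\<^sup>2)"
        using spread by (intro mult_left_mono coordinate_loss_le[OF G r]) (auto simp: G_def)
      also have "\<dots> = ennreal (?\<phi> * (2 * r + 2 * x\<^sup>2))"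
        using r by (simp add: ennreal_mult')
      finally show ?thesis using False by simp
    qed
  qed
  also have "\<dots> = (\<integral>\<^sup>+x. ?far x \<partial>lborel) + ennreal (1 / c) * (\<integral>\<^sup>+x. ?near x \<partial>lborel)"
    by (subst nn_integral_add) (auto simp: nn_integral_cmult)
  also have "\<dots> \<le> ennreal (sqrt 2 * exp (- \<zeta>\<^sup>2 / 4) * (2 * r + 4))
      + ennreal (1 / c) * (\<integral>\<^sup>+t. ennreal (f t) * ennreal (min (t * \<tau>\<^sup>2) (2 * \<zeta> ^ 3 / sqrt (t * \<tau>\<^sup>2))) \<partial>lborel)"
  proof (intro add_mono mult_left_mono)
    show "(\<integral>\<^sup>+x. ?far x \<partial>lborel) \<le> ennreal (sqrt 2 * exp (- \<zeta>\<^sup>2 / 4) * (2 * r + 4))"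
      using r \<zeta> by (intro normal_tail_quadratic) auto
    show "(\<integral>\<^sup>+x. ?near x \<partial>lborel)
        \<le> (\<integral>\<^sup>+t. ennreal (f t) * ennreal (min (t * \<tau>\<^sup>2) (2 * \<zeta> ^ 3 / sqrt (t * \<tau>\<^sup>2))) \<partial>lborel)"
      unfolding G_def truncated_sq_error_integral[OF f nonpos \<tau>]
    proof (intro nn_integral_mono)
      fix t
      show "ennreal (f t) * truncated_moment \<zeta> (t * \<tau>\<^sup>2)
          \<le> ennreal (f t) * ennreal (min (t * \<tau>\<^sup>2) (2 * \<zeta> ^ 3 / sqrt (t * \<tau>\<^sup>2)))"
      proof (cases "t \<le> 0")
        case False
        then have "0 < t * \<tau>\<^sup>2" using \<tau> by simp
        then show ?thesis
          using truncated_moment_le_variance truncated_moment_le_window[OF _ \<zeta>]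
          by (intro mult_left_mono) (auto simp: min_def)
      qed (simp add: nonpos)
    qed
  qed auto
  finally show ?thesis by (simp add: G_def)
qed

section \<open>Integrals against the mixing density\<close>

lemma nn_integral_powr_from_0:
  fixes q b :: real
  assumes "q < 1" "0 \<le> b"
  shows "(\<integral>\<^sup>+t. ennreal (t powr - q) * indicator {0..b} t \<partial>lborel) = ennreal (b powr (1 - q) / (1 - q))"
  using nn_integral_has_integral_lebesgue'[OF _ has_integral_powr_from_0[of "- q" b]] assms
  by (simp add: add.commute)

lemma nn_integral_powr_to_inf:
  fixes q b :: real
  assumes "1 < q" "0 < b"
  shows "(\<integral>\<^sup>+t. ennreal (t powr - q) * indicator {b..} t \<partial>lborel) = ennreal (b powr (1 - q) / (q - 1))"
proof -
  have "(\<integral>\<^sup>+t. ennreal (t powr - q) * indicator {b..} t \<partial>lborel) = ennreal (- (b powr (- q + 1)) / (- q + 1))"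
    using assms by (intro nn_integral_has_integral_lebesgue' has_integral_powr_to_inf) auto
  also have "- (b powr (- q + 1)) / (- q + 1) = b powr (1 - q) / (q - 1)"
    using assms by (simp add: divide_simps) (simp add: algebra_simps)
  finally show ?thesis .
qed

lemma nn_integral_inverse_Icc:
  fixes b :: real
  assumes "1 \<le> b"
  shows "(\<integral>\<^sup>+t. ennreal (t powr - 1) * indicator {1..b} t \<partial>lborel) = ennreal (ln b)"
proof -
  have "((\<lambda>t. t powr - 1) has_integral ln b - ln 1) {1..b}"
  proof (rule fundamental_theorem_of_calculus[OF assms])
    fix t :: real assume "t \<in> {1..b}"
    then have "0 < t" by simp
    then have "(ln has_real_derivative t powr - 1) (at t within {1..b})"
      by (auto intro!: derivative_eq_intros simp: powr_minus_divide)
    then show "(ln has_vector_derivative t powr - 1) (at t within {1..b})"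
      by (simp add: has_real_derivative_iff_has_vector_derivative)
  qed
  then show ?thesis by (intro nn_integral_has_integral_lebesgue') auto
qed

lemma mixing_density_upper:
  assumes "0 < K" "\<forall>t>0. L t \<le> M" "0 < t"
  shows "power_mixing_density K a L t \<le> K * M * t powr (- (a + 1))"
proof -
  have "K * t powr (- (a + 1)) * L t \<le> K * t powr (- (a + 1)) * M"
    using assms by (intro mult_left_mono) auto
  then show ?thesis using assms by (simp add: power_mixing_density_def ac_simps)
qed

text \<open>For \<open>a > 1\<close> the mixing density has a finite mean, so that the bound \<open>v = t * \<tau>\<^sup>2\<close> on the moment
  suffices and \<open>h\<close> is arbitrary.\<close>

lemma mixing_truncated_mean_gt_1:
  fixes K a M \<tau> :: real
  assumes dens: "is_prob_density (power_mixing_density K a L)"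
    and pos: "0 < K" "0 < M" and L_upper: "\<forall>t>0. L t \<le> M" and a: "1 < a"
  shows "(\<integral>\<^sup>+t. ennreal (power_mixing_density K a L t) * ennreal (min (t * \<tau>\<^sup>2) (h t)) \<partial>lborel)
       \<le> ennreal ((1 + K * M / (a - 1)) * \<tau>\<^sup>2)"
proof -
  let ?f = "power_mixing_density K a L"
  have [measurable]: "?f \<in> borel_measurable borel" and f0: "\<And>t. 0 \<le> ?f t"
    using dens by (auto simp: is_prob_density_def)
  have "(\<integral>\<^sup>+t. ennreal (?f t) * ennreal (min (t * \<tau>\<^sup>2) (h t)) \<partial>lborel)
      \<le> (\<integral>\<^sup>+t. ennreal (\<tau>\<^sup>2) * (ennreal (?f t) + ennreal (K * M) * (ennreal (t powr - a) * indicator {1..} t)) \<partial>lborel)"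
  proof (intro nn_integral_mono)
    fix t
    show "ennreal (?f t) * ennreal (min (t * \<tau>\<^sup>2) (h t))
       \<le> ennreal (\<tau>\<^sup>2) * (ennreal (?f t) + ennreal (K * M) * (ennreal (t powr - a) * indicator {1..} t))"
    proof (cases "1 \<le> t")
      case True
      have "?f t * t \<le> K * M * t powr (- (a + 1)) * t"
        using True pos mixing_density_upper[OF pos(1) L_upper, of t a] by (intro mult_right_mono) auto
      also have "\<dots> = K * M * t powr - a"
        using True powr_add[of t "- (a + 1)" 1] by simp
      finally have "?f t * t \<le> K * M * t powr - a" .
      then have "?f t * (t * \<tau>\<^sup>2) \<le> \<tau>\<^sup>2 * (K * M * t powr - a)"
        using mult_left_mono[of "?f t * t" "K * M * t powr - a" "\<tau>\<^sup>2"] by (simp add: ac_simps)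
      also have "\<dots> \<le> \<tau>\<^sup>2 * (?f t + K * M * t powr - a)"
        using f0 by (intro mult_left_mono) auto
      finally have "ennreal (?f t * (t * \<tau>\<^sup>2)) \<le> ennreal (\<tau>\<^sup>2 * (?f t + K * M * t powr - a))"
        by (rule ennreal_leI)
      moreover have "ennreal (?f t) * ennreal (min (t * \<tau>\<^sup>2) (h t)) \<le> ennreal (?f t * (t * \<tau>\<^sup>2))"
        unfolding ennreal_mult'[OF f0] by (intro mult_left_mono ennreal_leI) auto
      ultimately show ?thesis
        using f0 True pos by (simp add: ennreal_mult' ennreal_plus mult.assoc)
    next
      case False
      show ?thesis
      proof (cases "t \<le> 0")
        case False
        have "t * \<tau>\<^sup>2 \<le> 1 * \<tau>\<^sup>2" using \<open>\<not> 1 \<le> t\<close> by (intro mult_right_mono) auto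
        then show ?thesis using \<open>\<not> 1 \<le> t\<close>
          by (auto simp: mult.commute[of "ennreal (\<tau>\<^sup>2)"] intro!: mult_left_mono ennreal_leI min.coboundedI1)
      qed (simp add: power_mixing_density_nonpos)
    qed
  qed
  also have "\<dots> = ennreal (\<tau>\<^sup>2) * (1 + ennreal (K * M) * ennreal (1 powr (1 - a) / (a - 1)))"
    using dens a by (subst nn_integral_cmult, measurable, subst nn_integral_add, measurable, subst nn_integral_cmult, measurable)
      (simp add: nn_integral_powr_to_inf is_prob_density_def)
  also have "1 + ennreal (K * M) * ennreal (1 powr (1 - a) / (a - 1)) = ennreal (1 + K * M / (a - 1))"
    using pos a by (subst ennreal_plus) (auto simp: ennreal_mult'[symmetric])
  also have "ennreal (\<tau>\<^sup>2) * ennreal (1 + K * M / (a - 1)) = ennreal ((1 + K * M / (a - 1)) * \<tau>\<^sup>2)"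
    by (simp add: ennreal_mult'[symmetric] mult.commute)
  finally show ?thesis .
qed

text \<open>The part \<open>v \<ge> 1\<close> of the integral. There \<open>v powr (- a) \<le> v powr (- 1 / 2)\<close>, which reduces every exponent
  to \<open>a = 1 / 2\<close>; the two terms of the minimum are then used on either side of \<open>v = \<zeta>\<^sup>2\<close> and
  contribute equally.\<close>

lemma mixing_tail_truncated:
  fixes K a M \<tau> \<zeta> :: real
  assumes dens: "is_prob_density (power_mixing_density K a L)"
    and pos: "0 < K" "0 < M" and L_upper: "\<forall>t>0. L t \<le> M" and a: "1 / 2 \<le> a"
    and \<tau>: "0 < \<tau>" and \<zeta>: "1 \<le> \<zeta>"
  shows "(\<integral>\<^sup>+t. ennreal (power_mixing_density K a L t) * ennreal (min (t * \<tau>\<^sup>2) (2 * \<zeta> ^ 3 / sqrt (t * \<tau>\<^sup>2)))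
            * indicator {1 / \<tau>\<^sup>2..} t \<partial>lborel)
       \<le> ennreal (4 * K * M * \<zeta> * \<tau> powr (2 * a))"
proof -
  let ?f = "power_mixing_density K a L"
  \<comment> \<open>Corresponds to \<open>v = \<zeta>\<^sup>2\<close>, where the two terms of the minimum are of the same order.\<close>
  let ?T = "\<zeta>\<^sup>2 / \<tau>\<^sup>2"
  let ?c1 = "K * M * \<tau> powr (2 * a + 1)"
  let ?c2 = "2 * K * M * \<zeta> ^ 3 * \<tau> powr (2 * a) / \<tau>\<^sup>2"
  have f0: "\<And>t. 0 \<le> ?f t" using dens by (auto simp: is_prob_density_def)
  have "(\<integral>\<^sup>+t. ennreal (?f t) * ennreal (min (t * \<tau>\<^sup>2) (2 * \<zeta> ^ 3 / sqrt (t * \<tau>\<^sup>2)))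
            * indicator {1 / \<tau>\<^sup>2..} t \<partial>lborel)
      \<le> (\<integral>\<^sup>+t. ennreal ?c1 * (ennreal (t powr - (1 / 2)) * indicator {0..?T} t)
            + ennreal ?c2 * (ennreal (t powr - 2) * indicator {?T..} t) \<partial>lborel)"
  proof (intro nn_integral_mono)
    fix t
    show "ennreal (?f t) * ennreal (min (t * \<tau>\<^sup>2) (2 * \<zeta> ^ 3 / sqrt (t * \<tau>\<^sup>2))) * indicator {1 / \<tau>\<^sup>2..} t
       \<le> ennreal ?c1 * (ennreal (t powr - (1 / 2)) * indicator {0..?T} t)
            + ennreal ?c2 * (ennreal (t powr - 2) * indicator {?T..} t)"
    proof (cases "1 / \<tau>\<^sup>2 \<le> t")
      case True
      then have v: "1 \<le> t * \<tau>\<^sup>2" using \<tau> by (simp add: field_simps)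
      have "0 < 1 / \<tau>\<^sup>2" using \<tau> by simp
      with True have t: "0 < t" by linarith
      have "(t * \<tau>\<^sup>2) powr - a \<le> (t * \<tau>\<^sup>2) powr - (1 / 2)"
        using v a by (intro powr_mono) auto
      then have "t powr - a * \<tau>\<^sup>2 powr - a \<le> t powr - (1 / 2) * \<tau>\<^sup>2 powr - (1 / 2)"
        by (simp only: powr_mult)
      moreover have \<tau>p: "\<tau>\<^sup>2 powr q = \<tau> powr (2 * q)" for q
        using \<tau> powr_powr[of \<tau> 2 q] by simp
      ultimately have "t powr - a * \<tau> powr (- (2 * a)) * \<tau> powr (2 * a) \<le> t powr - (1 / 2) * \<tau> powr - 1 * \<tau> powr (2 * a)"
        by (intro mult_right_mono) auto
      then have ta: "t powr - a \<le> t powr - (1 / 2) * (\<tau> powr (2 * a) / \<tau>)"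
        using \<tau> by (simp add: mult.assoc powr_add[symmetric] powr_minus_divide)
      have "?f t \<le> K * M * (t powr - a / t)"
        using t mixing_density_upper[OF pos(1) L_upper t, of a] powr_add[of t "- a" "- 1"]
        by (simp add: powr_minus_divide)
      also have "\<dots> \<le> K * M * (t powr - (1 / 2) * (\<tau> powr (2 * a) / \<tau>) / t)"
        using pos t ta by (intro mult_left_mono divide_right_mono) auto
      finally have ft: "?f t \<le> K * M * (t powr - (1 / 2) * (\<tau> powr (2 * a) / \<tau>) / t)" .
      show ?thesis
      proof (cases "t \<le> ?T")
        case T: True
        have "?f t * min (t * \<tau>\<^sup>2) (2 * \<zeta> ^ 3 / sqrt (t * \<tau>\<^sup>2))
            \<le> K * M * (t powr - (1 / 2) * (\<tau> powr (2 * a) / \<tau>) / t) * (t * \<tau>\<^sup>2)"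
          using ft f0[of t] t \<tau> \<zeta> by (intro mult_mono) (auto simp: min_def)
        also have "\<dots> = ?c1 * t powr - (1 / 2)"
          using t \<tau> by (simp add: powr_add power2_eq_square)
        finally have "ennreal (?f t) * ennreal (min (t * \<tau>\<^sup>2) (2 * \<zeta> ^ 3 / sqrt (t * \<tau>\<^sup>2)))
            \<le> ennreal ?c1 * ennreal (t powr - (1 / 2))"
          using f0[of t] pos by (simp only: ennreal_mult'[symmetric] ennreal_leI powr_ge_zero mult_nonneg_nonneg less_imp_le)
        then show ?thesis using True T t by (simp add: add_increasing2)
      next
        case T: False
        have "?f t * min (t * \<tau>\<^sup>2) (2 * \<zeta> ^ 3 / sqrt (t * \<tau>\<^sup>2))
            \<le> K * M * (t powr - (1 / 2) * (\<tau> powr (2 * a) / \<tau>) / t) * (2 * \<zeta> ^ 3 / sqrt (t * \<tau>\<^sup>2))"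
          using ft f0[of t] t \<tau> \<zeta> by (intro mult_mono) (auto simp: min_def)
        also have "\<dots> = ?c2 * (t powr - (1 / 2) * t powr - (1 / 2) / t)"
        proof -
          have "K * M * (1 / s * (\<tau> powr (2 * a) / \<tau>) / t) * (2 * \<zeta> ^ 3 / (s * \<tau>)) = ?c2 * (1 / s * (1 / s) / t)" for s
            by (simp add: power2_eq_square ac_simps)
          moreover have "t powr - (1 / 2) = 1 / sqrt t" "sqrt (t * \<tau>\<^sup>2) = sqrt t * \<tau>"
            using t \<tau> by (auto simp: powr_minus_divide powr_half_sqrt real_sqrt_mult)
          ultimately show ?thesis by simp
        qed
        also have "t powr - (1 / 2) * t powr - (1 / 2) / t = t powr - 2"
          using t by (simp add: powr_minus_divide powr_half_sqrt power2_eq_square)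
        finally have "ennreal (?f t) * ennreal (min (t * \<tau>\<^sup>2) (2 * \<zeta> ^ 3 / sqrt (t * \<tau>\<^sup>2)))
            \<le> ennreal ?c2 * ennreal (t powr - 2)"
          using f0[of t] pos \<zeta> \<tau> by (subst (1 2) ennreal_mult'[symmetric]) (auto intro!: ennreal_leI)
        then show ?thesis using True T t by (simp add: add_increasing)
      qed
    qed simp
  qed
  also have "\<dots> = (\<integral>\<^sup>+t. ennreal ?c1 * (ennreal (t powr - (1 / 2)) * indicator {0..?T} t) \<partial>lborel)
      + (\<integral>\<^sup>+t. ennreal ?c2 * (ennreal (t powr - 2) * indicator {?T..} t) \<partial>lborel)"
    by (rule nn_integral_add) measurable
  also have "(\<integral>\<^sup>+t. ennreal ?c1 * (ennreal (t powr - (1 / 2)) * indicator {0..?T} t) \<partial>lborel)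
      = ennreal ?c1 * (\<integral>\<^sup>+t. ennreal (t powr - (1 / 2)) * indicator {0..?T} t \<partial>lborel)"
    by (rule nn_integral_cmult) measurable
  also have "(\<integral>\<^sup>+t. ennreal ?c2 * (ennreal (t powr - 2) * indicator {?T..} t) \<partial>lborel)
      = ennreal ?c2 * (\<integral>\<^sup>+t. ennreal (t powr - 2) * indicator {?T..} t \<partial>lborel)"
    by (rule nn_integral_cmult) measurable
  also have "(\<integral>\<^sup>+t. ennreal (t powr - (1 / 2)) * indicator {0..?T} t \<partial>lborel)
      = ennreal (?T powr (1 - 1 / 2) / (1 - 1 / 2))"
    by (rule nn_integral_powr_from_0) auto
  also have "(\<integral>\<^sup>+t. ennreal (t powr - 2) * indicator {?T..} t \<partial>lborel)
      = ennreal (?T powr (1 - 2) / (2 - 1))"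
    using \<tau> \<zeta> by (intro nn_integral_powr_to_inf) auto
  also have "ennreal ?c1 * ennreal (?T powr (1 - 1 / 2) / (1 - 1 / 2)) + ennreal ?c2 * ennreal (?T powr (1 - 2) / (2 - 1))
      = ennreal (?c1 * (?T powr (1 - 1 / 2) / (1 - 1 / 2)) + ?c2 * (?T powr (1 - 2) / (2 - 1)))"
  proof -
    have "ennreal ?c1 * ennreal (?T powr (1 - 1 / 2) / (1 - 1 / 2)) = ennreal (?c1 * (?T powr (1 - 1 / 2) / (1 - 1 / 2)))"
      "ennreal ?c2 * ennreal (?T powr (1 - 2) / (2 - 1)) = ennreal (?c2 * (?T powr (1 - 2) / (2 - 1)))"
      by (rule ennreal_mult[symmetric]; use pos \<zeta> in simp)+
    moreover have "0 \<le> ?c1 * (?T powr (1 - 1 / 2) / (1 - 1 / 2))" "0 \<le> ?c2 * (?T powr (1 - 2) / (2 - 1))"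
      using pos \<zeta> by (auto intro!: mult_nonneg_nonneg)
    ultimately show ?thesis by (simp only: ennreal_plus)
  qed
  also have "?c1 * (?T powr (1 - 1 / 2) / (1 - 1 / 2)) + ?c2 * (?T powr (1 - 2) / (2 - 1)) = 4 * K * M * \<zeta> * \<tau> powr (2 * a)"
  proof -
    have "?T powr (1 - 1 / 2) = \<zeta> / \<tau>"
      using \<tau> \<zeta> by (simp add: powr_half_sqrt real_sqrt_divide)
    moreover have "?T powr (1 - 2) = \<tau>\<^sup>2 / \<zeta>\<^sup>2"
      using \<tau> \<zeta> by (simp add: powr_minus_divide)
    moreover have "\<tau> powr (2 * a + 1) = \<tau> powr (2 * a) * \<tau>"
      using \<tau> by (simp add: powr_add)
    ultimately show ?thesis
      using \<tau> \<zeta> by (simp add: power2_eq_square power3_eq_cube)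
  qed
  finally show ?thesis .
qed

text \<open>The part \<open>v \<le> 1\<close> of the integral, for which \<open>v\<close> is the better bound. For \<open>a < 1\<close> the
  function \<open>t powr (- a)\<close> is integrable at 0.\<close>

lemma mixing_head_lt_1:
  fixes K a M \<tau> :: real
  assumes dens: "is_prob_density (power_mixing_density K a L)"
    and pos: "0 < K" "0 < M" and L_upper: "\<forall>t>0. L t \<le> M" and a: "a < 1"
    and \<tau>: "0 < \<tau>"
  shows "(\<integral>\<^sup>+t. ennreal (power_mixing_density K a L t) * ennreal (min (t * \<tau>\<^sup>2) (h t))
            * indicator {..1 / \<tau>\<^sup>2} t \<partial>lborel)
       \<le> ennreal (K * M / (1 - a) * \<tau> powr (2 * a))"
proof -
  let ?f = "power_mixing_density K a L"
  have f0: "\<And>t. 0 \<le> ?f t" using dens by (auto simp: is_prob_density_def)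
  have "(\<integral>\<^sup>+t. ennreal (?f t) * ennreal (min (t * \<tau>\<^sup>2) (h t)) * indicator {..1 / \<tau>\<^sup>2} t \<partial>lborel)
      \<le> (\<integral>\<^sup>+t. ennreal (K * M * \<tau>\<^sup>2) * (ennreal (t powr - a) * indicator {0..1 / \<tau>\<^sup>2} t) \<partial>lborel)"
  proof (intro nn_integral_mono)
    fix t
    show "ennreal (?f t) * ennreal (min (t * \<tau>\<^sup>2) (h t)) * indicator {..1 / \<tau>\<^sup>2} t
       \<le> ennreal (K * M * \<tau>\<^sup>2) * (ennreal (t powr - a) * indicator {0..1 / \<tau>\<^sup>2} t)"
    proof (cases "0 < t \<and> t \<le> 1 / \<tau>\<^sup>2")
      case True
      have "ennreal (?f t) * ennreal (min (t * \<tau>\<^sup>2) (h t)) \<le> ennreal (?f t * (t * \<tau>\<^sup>2))"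
        unfolding ennreal_mult'[OF f0] by (intro mult_left_mono ennreal_leI) auto
      also have "\<dots> \<le> ennreal (K * M * t powr (- (a + 1)) * (t * \<tau>\<^sup>2))"
        using True mixing_density_upper[OF pos(1) L_upper, of t a]
        by (intro ennreal_leI mult_right_mono) auto
      also have "K * M * t powr (- (a + 1)) * (t * \<tau>\<^sup>2) = K * M * \<tau>\<^sup>2 * t powr - a"
        using True powr_add[of t "- (a + 1)" 1] by simp
      also have "ennreal \<dots> = ennreal (K * M * \<tau>\<^sup>2) * ennreal (t powr - a)"
        using pos by (intro ennreal_mult) auto
      finally show ?thesis using True by simp
    qed (auto simp: power_mixing_density_nonpos not_less indicator_def)
  qed
  also have "\<dots> = ennreal (K * M * \<tau>\<^sup>2) * ennreal ((1 / \<tau>\<^sup>2) powr (1 - a) / (1 - a))"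
    using a by (subst nn_integral_cmult, measurable) (simp add: nn_integral_powr_from_0)
  also have "\<dots> = ennreal (K * M * \<tau>\<^sup>2 * ((1 / \<tau>\<^sup>2) powr (1 - a) / (1 - a)))"
    using pos by (intro ennreal_mult'[symmetric]) auto
  also have "K * M * \<tau>\<^sup>2 * ((1 / \<tau>\<^sup>2) powr (1 - a) / (1 - a)) = K * M / (1 - a) * \<tau> powr (2 * a)"
  proof -
    have "(1 / \<tau>\<^sup>2) powr (1 - a) = \<tau> powr (2 * a - 2)"
      using \<tau> powr_powr[of \<tau> "- 2" "1 - a"] by (simp add: powr_minus_divide algebra_simps)
    moreover have "\<tau> powr (2 * a) = \<tau> powr (2 * a - 2) * \<tau>\<^sup>2"
      using \<tau> powr_add[of \<tau> "2 * a - 2" 2] by simp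
    ultimately show ?thesis by simp
  qed
  finally show ?thesis .
qed

text \<open>For \<open>a = 1\<close> the upper bound on the mixing density is not integrable against \<open>t\<close> at 0, so the interval
  \<open>t \<le> 1\<close> is bounded by the total mass instead; the remaining interval produces the logarithm.\<close>

lemma mixing_head_eq_1:
  fixes K M \<tau> :: real
  assumes dens: "is_prob_density (power_mixing_density K 1 L)"
    and pos: "0 < K" "0 < M" and L_upper: "\<forall>t>0. L t \<le> M"
    and \<tau>: "0 < \<tau>" "\<tau> \<le> 1"
  shows "(\<integral>\<^sup>+t. ennreal (power_mixing_density K 1 L t) * ennreal (min (t * \<tau>\<^sup>2) (h t))
            * indicator {..1 / \<tau>\<^sup>2} t \<partial>lborel)
       \<le> ennreal (\<tau>\<^sup>2 * (1 + K * M * (2 * ln (1 / \<tau>))))"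
proof -
  let ?f = "power_mixing_density K 1 L"
  have [measurable]: "?f \<in> borel_measurable borel" and f0: "\<And>t. 0 \<le> ?f t"
    using dens by (auto simp: is_prob_density_def)
  have T: "1 \<le> 1 / \<tau>\<^sup>2" using \<tau> by (simp add: power_le_one)
  have "(\<integral>\<^sup>+t. ennreal (?f t) * ennreal (min (t * \<tau>\<^sup>2) (h t)) * indicator {..1 / \<tau>\<^sup>2} t \<partial>lborel)
      \<le> (\<integral>\<^sup>+t. ennreal (\<tau>\<^sup>2) * (ennreal (?f t) +
            ennreal (K * M) * (ennreal (t powr - 1) * indicator {1..1 / \<tau>\<^sup>2} t)) \<partial>lborel)"
  proof (intro nn_integral_mono)
    fix t
    have "ennreal (?f t) * ennreal (min (t * \<tau>\<^sup>2) (h t)) \<le> ennreal (?f t * (t * \<tau>\<^sup>2))"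
      unfolding ennreal_mult'[OF f0] by (intro mult_left_mono ennreal_leI) auto
    also have "?f t * (t * \<tau>\<^sup>2) = \<tau>\<^sup>2 * (?f t * t)" by simp
    also have "ennreal \<dots> = ennreal (\<tau>\<^sup>2) * ennreal (?f t * t)" by (intro ennreal_mult') simp
    finally have le: "ennreal (?f t) * ennreal (min (t * \<tau>\<^sup>2) (h t)) \<le> ennreal (\<tau>\<^sup>2) * ennreal (?f t * t)" .
    show "ennreal (?f t) * ennreal (min (t * \<tau>\<^sup>2) (h t)) * indicator {..1 / \<tau>\<^sup>2} t
       \<le> ennreal (\<tau>\<^sup>2) * (ennreal (?f t) + ennreal (K * M) * (ennreal (t powr - 1) * indicator {1..1 / \<tau>\<^sup>2} t))"
    proof (cases "1 \<le> t \<and> t \<le> 1 / \<tau>\<^sup>2")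
      case True
      have "?f t * t \<le> K * M * t powr (- (1 + 1)) * t"
        using True mixing_density_upper[OF pos(1) L_upper, of t 1] by (intro mult_right_mono) auto
      also have "\<dots> = K * M * t powr - 1"
        using True powr_add[of t "- (1 + 1)" 1] by simp
      finally have "ennreal (?f t * t) \<le> ennreal (K * M * t powr - 1)" by (rule ennreal_leI)
      also have "\<dots> = ennreal (K * M) * ennreal (t powr - 1)" using pos by (intro ennreal_mult) auto
      finally show ?thesis using True
        by (auto intro!: order_trans[OF le] mult_left_mono add_increasing)
    next
      case False
      show ?thesis
      proof (cases "t \<le> 1 / \<tau>\<^sup>2")
        case True
        then have "t < 1" using False by auto
        then have "ennreal (?f t * t) \<le> ennreal (?f t)"
          using f0[of t] by (intro ennreal_leI) (simp add: mult_left_le)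
        then show ?thesis using True
          by (auto intro!: order_trans[OF le] mult_left_mono add_increasing2)
      qed simp
    qed
  qed
  also have "\<dots> = ennreal (\<tau>\<^sup>2) * (1 + ennreal (K * M) * ennreal (ln (1 / \<tau>\<^sup>2)))"
    using dens T by (subst nn_integral_cmult, measurable, subst nn_integral_add, measurable, subst nn_integral_cmult, measurable)
      (simp only: nn_integral_inverse_Icc is_prob_density_def)
  also have "1 + ennreal (K * M) * ennreal (ln (1 / \<tau>\<^sup>2)) = ennreal (1 + K * M * ln (1 / \<tau>\<^sup>2))"
    using pos T by (subst ennreal_plus) (auto simp: ennreal_mult)
  also have "ennreal (\<tau>\<^sup>2) * ennreal (1 + K * M * ln (1 / \<tau>\<^sup>2)) = ennreal (\<tau>\<^sup>2 * (1 + K * M * ln (1 / \<tau>\<^sup>2)))"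
    by (intro ennreal_mult'[symmetric]) auto
  also have "ln (1 / \<tau>\<^sup>2) = 2 * ln (1 / \<tau>)"
    using \<tau> by (simp add: ln_div ln_realpow)
  finally show ?thesis .
qed

lemma mixing_head_plus_tail:
  fixes K a M \<tau> \<zeta> H :: real
  assumes dens: "is_prob_density (power_mixing_density K a L)"
    and pos: "0 < K" "0 < M" and L_upper: "\<forall>t>0. L t \<le> M" and a: "1 / 2 \<le> a"
    and \<tau>: "0 < \<tau>" and \<zeta>: "1 \<le> \<zeta>" and H: "0 \<le> H"
    and head: "(\<integral>\<^sup>+t. ennreal (power_mixing_density K a L t) * ennreal (min (t * \<tau>\<^sup>2) (2 * \<zeta> ^ 3 / sqrt (t * \<tau>\<^sup>2)))
            * indicator {..1 / \<tau>\<^sup>2} t \<partial>lborel) \<le> ennreal H"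
  shows "(\<integral>\<^sup>+t. ennreal (power_mixing_density K a L t) * ennreal (min (t * \<tau>\<^sup>2) (2 * \<zeta> ^ 3 / sqrt (t * \<tau>\<^sup>2))) \<partial>lborel)
       \<le> ennreal (H + 4 * K * M * \<zeta> * \<tau> powr (2 * a))"
proof -
  let ?g = "\<lambda>t. ennreal (power_mixing_density K a L t) * ennreal (min (t * \<tau>\<^sup>2) (2 * \<zeta> ^ 3 / sqrt (t * \<tau>\<^sup>2)))"
  have [measurable]: "power_mixing_density K a L \<in> borel_measurable borel"
    using dens by (simp add: is_prob_density_def)
  have "(\<integral>\<^sup>+t. ?g t \<partial>lborel) \<le> (\<integral>\<^sup>+t. ?g t * indicator {..1 / \<tau>\<^sup>2} t + ?g t * indicator {1 / \<tau>\<^sup>2..} t \<partial>lborel)"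
    by (intro nn_integral_mono) (auto simp: indicator_def)
  also have "\<dots> = (\<integral>\<^sup>+t. ?g t * indicator {..1 / \<tau>\<^sup>2} t \<partial>lborel) + (\<integral>\<^sup>+t. ?g t * indicator {1 / \<tau>\<^sup>2..} t \<partial>lborel)"
    by (intro nn_integral_add) measurable
  also have "\<dots> \<le> ennreal H + ennreal (4 * K * M * \<zeta> * \<tau> powr (2 * a))"
    by (intro add_mono head mixing_tail_truncated[OF dens pos L_upper a \<tau> \<zeta>])
  also have "\<dots> = ennreal (H + 4 * K * M * \<zeta> * \<tau> powr (2 * a))"
    using pos \<zeta> H by (intro ennreal_plus[symmetric]) auto
  finally show ?thesis .
qed

text \<open>Each regime of \<open>a\<close> has its own condition on \<open>\<tau>\<close>, matched to the order of the integral. For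
  \<open>a < 1\<close> the condition already allows \<open>sqrt l\<close>, and \<open>\<zeta>\<close> supplies the other \<open>sqrt l\<close>; for \<open>a = 1\<close> the
  logarithm of \<open>1 / \<tau>\<close> is \<open>\<alpha> * l\<close>.\<close>

lemma mixing_integral_bound:
  fixes K a M \<alpha> :: real
  assumes dens: "is_prob_density (power_mixing_density K a L)"
    and pos: "0 < K" "0 < M" and L_upper: "\<forall>t>0. L t \<le> M" and a: "1 / 2 \<le> a" and \<alpha>: "0 \<le> \<alpha>"
  obtains C where "0 \<le> C"
    "\<And>s l \<tau> \<zeta>. \<lbrakk>s = exp (- l); 1 \<le> l; \<tau> = s powr \<alpha>; \<zeta> = 2 * sqrt l;
        a < 1 \<Longrightarrow> \<tau> powr (2 * a) \<le> s * sqrt l; a = 1 \<Longrightarrow> \<tau>\<^sup>2 \<le> s; 1 < a \<Longrightarrow> \<tau>\<^sup>2 \<le> s * l\<rbrakk> \<Longrightarrow>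
      (\<integral>\<^sup>+t. ennreal (power_mixing_density K a L t) * ennreal (min (t * \<tau>\<^sup>2) (2 * \<zeta> ^ 3 / sqrt (t * \<tau>\<^sup>2))) \<partial>lborel)
       \<le> ennreal (C * (s * l))"
proof -
  consider "a < 1" | "a = 1" | "1 < a" by linarith
  then show thesis
  proof cases
    case 1
    let ?C = "K * M / (1 - a) + 8 * K * M"
    show thesis
    proof (rule that[of ?C])
      show C: "0 \<le> ?C" using pos 1 by simp
      fix s l \<tau> \<zeta> :: real
      assume s: "s = exp (- l)" and l: "1 \<le> l" and \<tau>: "\<tau> = s powr \<alpha>" and \<zeta>: "\<zeta> = 2 * sqrt l"
        and small: "a < 1 \<Longrightarrow> \<tau> powr (2 * a) \<le> s * sqrt l"
      have \<tau>0: "0 < \<tau>" by (simp add: \<tau> s)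
      have w: "1 \<le> sqrt l" "sqrt l * sqrt l = l" using l by auto
      have "sqrt l * 1 \<le> sqrt l * sqrt l" using w(1) by (intro mult_left_mono) auto
      then have wl: "sqrt l \<le> l" unfolding w(2) mult_1_right .
      have \<zeta>1: "1 \<le> \<zeta>" using w(1) unfolding \<zeta> by linarith
      have H: "0 \<le> K * M / (1 - a) * \<tau> powr (2 * a)" using pos 1 by simp
      have "K * M / (1 - a) * \<tau> powr (2 * a) + 4 * K * M * \<zeta> * \<tau> powr (2 * a)
          = (K * M / (1 - a) + 8 * K * M * sqrt l) * \<tau> powr (2 * a)"
        by (simp add: \<zeta> distrib_right)
      also have "\<dots> \<le> (K * M / (1 - a) + 8 * K * M * sqrt l) * (s * sqrt l)"
        using small 1 pos w by (intro mult_left_mono) (auto intro!: add_nonneg_nonneg)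
      also have "\<dots> = K * M / (1 - a) * s * sqrt l + 8 * K * M * s * (sqrt l * sqrt l)"
        by (simp only: distrib_right distrib_left ac_simps)
      also have "\<dots> \<le> K * M / (1 - a) * s * l + 8 * K * M * s * l"
        unfolding w(2) using wl pos 1 by (intro add_right_mono mult_left_mono) (auto simp: s)
      also have "\<dots> = ?C * (s * l)" by (simp only: distrib_right distrib_left ac_simps)
      finally have le: "K * M / (1 - a) * \<tau> powr (2 * a) + 4 * K * M * \<zeta> * \<tau> powr (2 * a) \<le> ?C * (s * l)" .
      show "(\<integral>\<^sup>+t. ennreal (power_mixing_density K a L t) * ennreal (min (t * \<tau>\<^sup>2) (2 * \<zeta> ^ 3 / sqrt (t * \<tau>\<^sup>2))) \<partial>lborel)
          \<le> ennreal (?C * (s * l))"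
        by (rule order_trans[OF mixing_head_plus_tail[OF dens pos L_upper a \<tau>0 \<zeta>1 H
            mixing_head_lt_1[OF dens pos L_upper 1 \<tau>0]] ennreal_leI[OF le]])
    qed
  next
    case 2
    let ?C = "1 + 2 * K * M * \<alpha> + 8 * K * M"
    show thesis
    proof (rule that[of ?C])
      show C: "0 \<le> ?C" using pos \<alpha> by simp
      fix s l \<tau> \<zeta> :: real
      assume s: "s = exp (- l)" and l: "1 \<le> l" and \<tau>: "\<tau> = s powr \<alpha>" and \<zeta>: "\<zeta> = 2 * sqrt l"
        and small: "a = 1 \<Longrightarrow> \<tau>\<^sup>2 \<le> s"
      have \<tau>e: "\<tau> = exp (- (\<alpha> * l))" by (simp add: \<tau> s powr_def)
      have \<tau>0: "0 < \<tau>" "\<tau> \<le> 1" using \<alpha> l by (auto simp: \<tau>e)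
      have ln: "ln (1 / \<tau>) = \<alpha> * l" by (simp add: \<tau>e ln_div)
      have w: "1 \<le> sqrt l" "sqrt l * sqrt l = l" using l by auto
      have "sqrt l * 1 \<le> sqrt l * sqrt l" using w(1) by (intro mult_left_mono) auto
      then have wl: "sqrt l \<le> l" unfolding w(2) mult_1_right .
      have \<zeta>1: "1 \<le> \<zeta>" using w(1) unfolding \<zeta> by linarith
      have H: "0 \<le> \<tau>\<^sup>2 * (1 + K * M * (2 * ln (1 / \<tau>)))" using pos \<alpha> l unfolding ln by simp
      have "\<tau>\<^sup>2 * (1 + K * M * (2 * ln (1 / \<tau>))) + 4 * K * M * \<zeta> * \<tau> powr (2 * a)
          = \<tau>\<^sup>2 * (1 + 2 * K * M * \<alpha> * l + 8 * K * M * sqrt l)"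
        unfolding ln using \<tau>0 by (simp add: \<zeta> 2 distrib_left)
      also have "\<dots> \<le> s * (l + 2 * K * M * \<alpha> * l + 8 * K * M * l)"
        using small 2 pos wl \<alpha> l
        by (intro mult_mono add_mono mult_left_mono) (auto simp: s intro!: add_nonneg_nonneg)
      also have "\<dots> = ?C * (s * l)" by (simp add: algebra_simps)
      finally have le: "\<tau>\<^sup>2 * (1 + K * M * (2 * ln (1 / \<tau>))) + 4 * K * M * \<zeta> * \<tau> powr (2 * a) \<le> ?C * (s * l)" .
      show "(\<integral>\<^sup>+t. ennreal (power_mixing_density K a L t) * ennreal (min (t * \<tau>\<^sup>2) (2 * \<zeta> ^ 3 / sqrt (t * \<tau>\<^sup>2))) \<partial>lborel)
          \<le> ennreal (?C * (s * l))"
        unfolding 2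
        by (rule order_trans[OF mixing_head_plus_tail[OF dens[unfolded 2] pos L_upper a[unfolded 2] \<tau>0(1) \<zeta>1 H
            mixing_head_eq_1[OF dens[unfolded 2] pos L_upper \<tau>0]] ennreal_leI[OF le[unfolded 2]]])
    qed
  next
    case 3
    let ?C = "1 + K * M / (a - 1)"
    show thesis
    proof (rule that[of ?C])
      show C: "0 \<le> ?C" using pos 3 by simp
      fix s l \<tau> \<zeta> :: real
      assume small: "1 < a \<Longrightarrow> \<tau>\<^sup>2 \<le> s * l"
      have "?C * \<tau>\<^sup>2 \<le> ?C * (s * l)" using small 3 C by (intro mult_left_mono) auto
      then show "(\<integral>\<^sup>+t. ennreal (power_mixing_density K a L t) * ennreal (min (t * \<tau>\<^sup>2) (2 * \<zeta> ^ 3 / sqrt (t * \<tau>\<^sup>2))) \<partial>lborel)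
          \<le> ennreal (?C * (s * l))"
        by (intro order_trans[OF mixing_truncated_mean_gt_1[OF dens pos L_upper 3] ennreal_leI])
    qed
  qed
qed

section \<open>The risk bounds and their consequences\<close>

lemma coordinate_risk_bounds:
  fixes K a M c0 t0 \<alpha> :: real
  assumes dens: "is_prob_density (power_mixing_density K a L)"
    and pos: "0 < K" "0 < c0" "0 < M" "0 < t0"
    and L_lower: "\<forall>t\<ge>t0. c0 < L t" and L_upper: "\<forall>t>0. L t \<le> M"
    and a: "1 / 2 \<le> a" and \<alpha>: "0 \<le> \<alpha>"
  obtains C where "0 < C"
    "\<And>s l \<tau> m. \<lbrakk>s = exp (- l); 1 \<le> l; t0 \<le> l; \<tau> = s powr \<alpha>;
        a < 1 \<Longrightarrow> \<tau> powr (2 * a) \<le> s * sqrt l; a = 1 \<Longrightarrow> \<tau>\<^sup>2 \<le> s; 1 < a \<Longrightarrow> \<tau>\<^sup>2 \<le> s * l\<rbrakk> \<Longrightarrow>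
      coordinate_risk (scaled_normal_mixture (power_mixing_density K a L) \<tau>) 0 \<le> ennreal (C * (s * l)) \<and>
      coordinate_risk (scaled_normal_mixture (power_mixing_density K a L) \<tau>) m \<le> ennreal (C * l)"
proof -
  let ?f = "power_mixing_density K a L"
  have a0: "0 < a" using a by simp
  have nonpos: "\<forall>t\<le>0. ?f t = 0" by (simp add: power_mixing_density_nonpos)
  have A: "0 \<le> 2 * a * \<alpha>" using a \<alpha> by simp
  obtain C1 where C1: "0 < C1"
    and spread: "\<And>\<tau> l x. \<lbrakk>0 < \<tau>; \<tau> \<le> 1; 1 \<le> l; t0 \<le> l; exp (- (2 * a * \<alpha> * l)) \<le> \<tau> powr (2 * a)\<rbrakk> \<Longrightarrow>
      sq_error_integral (scaled_normal_mixture ?f \<tau>) x x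
       \<le> ennreal (C1 * l) * evidence (scaled_normal_mixture ?f \<tau>) x"
    using posterior_spread_about_observation[OF dens pos(1) a0 pos(2,4) L_lower A] by blast
  obtain c where c: "0 < c"
    and lower: "\<And>\<tau> x. 0 < \<tau> \<Longrightarrow> \<tau> \<le> 1 \<Longrightarrow>
      ennreal (c * normal_density 0 1 x) \<le> evidence (scaled_normal_mixture ?f \<tau>) x"
    using evidence_ge_standard_normal[OF dens nonpos] by blast
  obtain C3 where C3: "0 \<le> C3"
    and mixing: "\<And>s l \<tau> \<zeta>. \<lbrakk>s = exp (- l); 1 \<le> l; \<tau> = s powr \<alpha>; \<zeta> = 2 * sqrt l;
        a < 1 \<Longrightarrow> \<tau> powr (2 * a) \<le> s * sqrt l; a = 1 \<Longrightarrow> \<tau>\<^sup>2 \<le> s; 1 < a \<Longrightarrow> \<tau>\<^sup>2 \<le> s * l\<rbrakk> \<Longrightarrow>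
      (\<integral>\<^sup>+t. ennreal (?f t) * ennreal (min (t * \<tau>\<^sup>2) (2 * \<zeta> ^ 3 / sqrt (t * \<tau>\<^sup>2))) \<partial>lborel)
       \<le> ennreal (C3 * (s * l))"
    using mixing_integral_bound[OF dens pos(1,3) L_upper a \<alpha>] by blast
  define C where "C = sqrt 2 * (2 * C1 + 4) + C3 / c + 2 * C1 + 2"
  show thesis
  proof (rule that[of C])
    show "0 < C" using C1 C3 c by (auto simp: C_def intro!: add_nonneg_pos add_nonneg_nonneg)
    fix s l \<tau> m :: real
    assume s: "s = exp (- l)" and l: "1 \<le> l" "t0 \<le> l" and \<tau>: "\<tau> = s powr \<alpha>"
      and small: "a < 1 \<Longrightarrow> \<tau> powr (2 * a) \<le> s * sqrt l" "a = 1 \<Longrightarrow> \<tau>\<^sup>2 \<le> s" "1 < a \<Longrightarrow> \<tau>\<^sup>2 \<le> s * l"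
    let ?G = "scaled_normal_mixture ?f \<tau>"
    define \<zeta> where "\<zeta> = 2 * sqrt l"
    have G: "prob_space ?G" "sets ?G = sets borel"
      using prob_space_scaled_normal_mixture[OF dens] by auto
    have \<tau>e: "\<tau> = exp (- (\<alpha> * l))" by (simp add: \<tau> s powr_def)
    have \<tau>0: "0 < \<tau>" "\<tau> \<le> 1" using \<alpha> l by (auto simp: \<tau>e)
    have "exp (- (2 * a * \<alpha> * l)) \<le> \<tau> powr (2 * a)" by (simp add: \<tau>e powr_def)
    note spread' = spread[OF \<tau>0 l this]
    have r: "0 \<le> C1 * l" using C1 l by simp
    have "1 \<le> sqrt l" using l by simp
    then have \<zeta>1: "1 \<le> \<zeta>" unfolding \<zeta>_def by linarith
    have \<zeta>2: "exp (- \<zeta>\<^sup>2 / 4) = s" using l by (simp add: \<zeta>_def s power_mult_distrib)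
    have sl: "0 < s" "s \<le> s * l" using l by (auto simp: s)
    have "coordinate_risk ?G 0 \<le> ennreal (sqrt 2 * s * (2 * (C1 * l) + 4)) + ennreal (1 / c) * ennreal (C3 * (s * l))"
      using coordinate_risk_zero_le[OF dens nonpos \<tau>0(1) r c \<zeta>1 spread' lower[OF \<tau>0]]
      unfolding \<zeta>2
      by (rule order_trans) (intro add_left_mono mult_left_mono mixing[OF s l(1) \<tau> \<zeta>_def small], auto)
    also have "\<dots> = ennreal (sqrt 2 * s * (2 * (C1 * l) + 4) + C3 / c * (s * l))"
      using C1 C3 c sl l by (subst ennreal_plus) (auto simp: ennreal_mult'[symmetric])
    also have "\<dots> \<le> ennreal (C * (s * l))"
    proof (rule ennreal_leI)
      have "sqrt 2 * s * (2 * (C1 * l) + 4) = sqrt 2 * (2 * C1 * (s * l) + 4 * s)"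
        by (simp add: algebra_simps)
      also have "\<dots> \<le> sqrt 2 * (2 * C1 * (s * l) + 4 * (s * l))"
        using sl by (intro mult_left_mono add_left_mono) auto
      finally have "sqrt 2 * s * (2 * (C1 * l) + 4) \<le> sqrt 2 * (2 * C1 + 4) * (s * l)"
        by (simp add: algebra_simps)
      moreover have "0 \<le> (2 * C1 + 2) * (s * l)" using C1 sl l by simp
      moreover have "C * (s * l) = sqrt 2 * (2 * C1 + 4) * (s * l) + C3 / c * (s * l) + (2 * C1 + 2) * (s * l)"
        by (simp only: C_def distrib_right add.assoc)
      ultimately show "sqrt 2 * s * (2 * (C1 * l) + 4) + C3 / c * (s * l) \<le> C * (s * l)"
        by linarith
    qed
    finally have zero: "coordinate_risk ?G 0 \<le> ennreal (C * (s * l))" .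
    have "coordinate_risk ?G m \<le> ennreal (2 * (C1 * l) + 2)"
      by (rule coordinate_risk_le[OF G r spread'])
    also have "\<dots> \<le> ennreal (C * l)"
    proof (rule ennreal_leI)
      have "2 * (C1 * l) + 2 \<le> (2 * C1 + 2) * l" using l by (simp add: algebra_simps)
      also have "\<dots> \<le> C * l"
        using C1 C3 c l by (intro mult_right_mono) (auto simp: C_def)
      finally show "2 * (C1 * l) + 2 \<le> C * l" .
    qed
    finally show "coordinate_risk ?G 0 \<le> ennreal (C * (s * l)) \<and> coordinate_risk ?G m \<le> ennreal (C * l)"
      using zero by blast
  qed
qed

theorem mainTheorem2:
  fixes p \<tau> :: "nat \<Rightarrow> real" and a K \<alpha> c0 M t0 :: real and L :: "real \<Rightarrow> real"
    and prior :: "nat \<Rightarrow> (nat \<Rightarrow> real) measure"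
  assumes p_bounds: "\<forall>\<^sub>F n in sequentially. 0 < p n \<and> p n < real n"
    and p_small: "p \<in> o(\<lambda>n. real n)"
    and a: "1 / 2 \<le> a"
    and K: "0 < K"
    and density: "is_prob_density (power_mixing_density K a L)"
    and L_pos: "\<forall>t>0. 0 < L t"
    and L_nonconstant: "\<exists>s>0. \<exists>t>0. L s \<noteq> L t"
    and constants: "0 < c0" "0 < M" "0 < t0"
    and L_lower: "\<forall>t\<ge>t0. c0 < L t"
    and L_upper: "\<forall>t>0. L t \<le> M"
    and \<alpha>: "0 \<le> \<alpha>"
    and \<tau>_def: "\<tau> = (\<lambda>n. (p n / real n) powr \<alpha>)"
    and \<tau>_a_less_1: "a < 1 \<Longrightarrow> \<forall>\<^sub>F n in sequentially.
           \<tau> n powr (2 * a) \<le> p n / real n * sqrt (ln (real n / p n))"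
    and \<tau>_a_eq_1: "a = 1 \<Longrightarrow> \<forall>\<^sub>F n in sequentially. (\<tau> n)\<^sup>2 \<le> p n / real n"
    and \<tau>_a_greater_1: "1 < a \<Longrightarrow> \<forall>\<^sub>F n in sequentially.
           (\<tau> n)\<^sup>2 \<le> p n / real n * ln (real n / p n)"
    and prior_def: "prior = (\<lambda>n. scaled_normal_mixture_prior n (power_mixing_density K a L) (\<tau> n))"
  shows "(\<forall>m :: nat \<Rightarrow> real. (\<forall>n. 0 < m n) \<longrightarrow> filterlim m at_top sequentially \<longrightarrow>
            (\<lambda>n. SUP \<theta>0 \<in> sparse_vectors n (p n).
                expected_posterior_mass_outside n (prior n) \<theta>0 (m n * p n * ln (real n / p n)))
              \<longlonglongrightarrow> 0)
       \<and> (\<exists>C::real. 0 < C \<and> (\<forall>\<^sub>F n in sequentially.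
            (SUP \<theta>0 \<in> sparse_vectors n (p n). posterior_mean_risk n (prior n) \<theta>0)
              \<le> ennreal (C * p n * ln (real n / p n))))"
proof -
  let ?f = "power_mixing_density K a L"
  let ?G = "\<lambda>n. scaled_normal_mixture ?f (\<tau> n)"
  let ?l = "\<lambda>n. ln (real n / p n)"
  have prior: "prior n = iid_prior n (?G n)" for n
    by (simp add: prior_def scaled_normal_mixture_prior_def iid_prior_def)
  have G: "prob_space (?G n)" "sets (?G n) = sets borel" for n
    using prob_space_scaled_normal_mixture[OF density] by auto
  obtain C where C: "0 < C"
    and bounds: "\<And>s l \<tau> m. \<lbrakk>s = exp (- l); 1 \<le> l; t0 \<le> l; \<tau> = s powr \<alpha>;
        a < 1 \<Longrightarrow> \<tau> powr (2 * a) \<le> s * sqrt l; a = 1 \<Longrightarrow> \<tau>\<^sup>2 \<le> s; 1 < a \<Longrightarrow> \<tau>\<^sup>2 \<le> s * l\<rbrakk> \<Longrightarrow>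
      coordinate_risk (scaled_normal_mixture ?f \<tau>) 0 \<le> ennreal (C * (s * l)) \<and>
      coordinate_risk (scaled_normal_mixture ?f \<tau>) m \<le> ennreal (C * l)"
    using coordinate_risk_bounds[OF density K constants L_lower L_upper a \<alpha>] by blast
  have "(\<lambda>n. p n / real n) \<longlonglongrightarrow> 0"
    using p_small by (rule smalloD_tendsto)
  then have "filterlim (\<lambda>n. p n / real n) (at_right 0) sequentially"
    unfolding filterlim_at using p_bounds
    by (auto elim!: eventually_mono intro: divide_pos_pos less_trans)
  then have "filterlim (\<lambda>n. ln (inverse (p n / real n))) at_top sequentially"
    by (intro filterlim_compose[OF ln_at_top] filterlim_compose[OF filterlim_inverse_at_top_right])
  then have l_top: "filterlim ?l at_top sequentially" by simp
  have "\<forall>\<^sub>F n in sequentially. a < 1 \<longrightarrow> \<tau> n powr (2 * a) \<le> p n / real n * sqrt (?l n)"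
    "\<forall>\<^sub>F n in sequentially. a = 1 \<longrightarrow> (\<tau> n)\<^sup>2 \<le> p n / real n"
    "\<forall>\<^sub>F n in sequentially. 1 < a \<longrightarrow> (\<tau> n)\<^sup>2 \<le> p n / real n * ?l n"
    using \<tau>_a_less_1 \<tau>_a_eq_1 \<tau>_a_greater_1 by (auto intro: eventually_mono)
  moreover have "\<forall>\<^sub>F n in sequentially. 1 \<le> ?l n" "\<forall>\<^sub>F n in sequentially. t0 \<le> ?l n"
    using l_top by (auto simp: filterlim_at_top)
  ultimately have risk: "\<forall>\<^sub>F n in sequentially. 0 < p n \<and> 0 < ?l n \<and> (\<forall>\<eta>\<in>sparse_vectors n (p n).
      (\<Sum>i<n. coordinate_risk (?G n) (\<eta> i)) \<le> ennreal (2 * C * p n * ?l n))"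
    using p_bounds
  proof eventually_elim
    case (elim n)
    have n: "0 < real n" using elim by linarith
    have s: "p n / real n = exp (- ?l n)" using elim n by (simp add: ln_div exp_diff)
    have bound: "coordinate_risk (?G n) 0 \<le> ennreal (C * (p n / real n * ?l n)) \<and>
        coordinate_risk (?G n) m \<le> ennreal (C * ?l n)" for m
      using elim by (intro bounds[OF s]) (auto simp: \<tau>_def)
    have "(\<Sum>i<n. coordinate_risk (?G n) (\<eta> i)) \<le> ennreal (2 * C * p n * ?l n)"
      if \<eta>: "\<eta> \<in> sparse_vectors n (p n)" for \<eta>
    proof -
      have "(\<Sum>i<n. coordinate_risk (?G n) (\<eta> i))
          \<le> ennreal (real n * (C * (p n / real n * ?l n)) + p n * (C * ?l n))"
        using elim bound C by (intro sum_coordinate_risk_sparse_le[OF \<eta>]) auto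
      also have "real n * (C * (p n / real n * ?l n)) + p n * (C * ?l n) = 2 * C * p n * ?l n"
        using n by simp
      finally show ?thesis .
    qed
    with elim show ?case by auto
  qed
  show ?thesis
  proof (intro conjI allI impI)
    fix m :: "nat \<Rightarrow> real"
    assume m: "\<forall>n. 0 < m n" "filterlim m at_top sequentially"
    let ?S = "\<lambda>n. SUP \<theta>0 \<in> sparse_vectors n (p n).
        expected_posterior_mass_outside n (prior n) \<theta>0 (m n * p n * ?l n)"
    have "\<forall>\<^sub>F n in sequentially. ?S n \<le> ennreal (2 * C / m n)"
      using risk
    proof eventually_elim
      case (elim n)
      have pos: "0 < m n * p n * ?l n" using elim m by simp
      show ?case
      proof (rule SUP_least)
        fix \<eta> assume \<eta>: "\<eta> \<in> sparse_vectors n (p n)"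
        have "expected_posterior_mass_outside n (prior n) \<eta> (m n * p n * ?l n)
            \<le> (\<Sum>i<n. coordinate_risk (?G n) (\<eta> i)) / ennreal (m n * p n * ?l n)"
          unfolding prior by (rule expected_posterior_mass_outside_le[OF G pos])
        also have "\<dots> \<le> ennreal (2 * C * p n * ?l n) / ennreal (m n * p n * ?l n)"
          using elim \<eta> by (intro divide_right_mono_ennreal) auto
        also have "\<dots> = ennreal (2 * C * p n * ?l n / (m n * p n * ?l n))"
          using elim pos C by (intro divide_ennreal) auto
        also have "2 * C * p n * ?l n / (m n * p n * ?l n) = 2 * C / m n"
          using elim by (metis mult_divide_mult_cancel_right less_irrefl)
        finally show "expected_posterior_mass_outside n (prior n) \<eta> (m n * p n * ?l n) \<le> ennreal (2 * C / m n)" .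
      qed
    qed
    moreover have "(\<lambda>n. ennreal (2 * C / m n)) \<longlonglongrightarrow> ennreal 0"
      using m by (intro tendsto_ennrealI real_tendsto_divide_at_top[OF tendsto_const])
    then have "(\<lambda>n. ennreal (2 * C / m n)) \<longlonglongrightarrow> 0" by simp
    ultimately show "?S \<longlonglongrightarrow> 0"
      using tendsto_sandwich[OF _ _ tendsto_const, of 0 ?S sequentially "\<lambda>n. ennreal (2 * C / m n)"]
      by simp
  next
    have "\<forall>\<^sub>F n in sequentially.
        (SUP \<theta>0 \<in> sparse_vectors n (p n). posterior_mean_risk n (prior n) \<theta>0) \<le> ennreal (2 * C * p n * ?l n)"
      using risk
    proof eventually_elim
      case (elim n)
      then show ?case unfolding prior
        by (intro SUP_least order_trans[OF posterior_mean_risk_le[OF G]]) auto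
    qed
    then show "\<exists>C::real. 0 < C \<and> (\<forall>\<^sub>F n in sequentially.
        (SUP \<theta>0 \<in> sparse_vectors n (p n). posterior_mean_risk n (prior n) \<theta>0)
          \<le> ennreal (C * p n * ln (real n / p n)))"
      using C by (intro exI[of _ "2 * C"]) auto
  qed
qed

end
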